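(* Let $N,s\in\mathbb{N}$, $\boldsymbol{z}\in\{1,\ldots,N-1\}^s$, and let $\boldsymbol{\gamma}=(\gamma_u)_{u\subseteq 1:s}$ be weights with $\gamma_u\ge0$. The squared worst-case error of the tent-transformed rank-1 lattice rule in $\mathcal{H}(K_{2,\boldsymbol{\gamma},s}^{\mathrm{sob}})$ is bounded by $$\left(e^{\mathrm{wor}}(P_{N,\boldsymbol{z}}^{\phi};\mathcal{H}(K_{2,\boldsymbol{\gamma},s}^{\mathrm{sob}}))\right)^2\le\sum_{\emptyset\ne u\subseteq 1:s}\gamma'_u\left(\sum_{\boldsymbol{k}_u\in P_{N,\boldsymbol{z}}^{\perp,u}}\prod_{j\in u}\frac{1}{k_j^2}\right)^2\le\left(e^{\mathrm{wor}}(P_{N,\boldsymbol{z}};\mathcal{H}(K_{1,\boldsymbol{\gamma}'^{1/2},s}^{\mathrm{kor}}))\right)^4,$$ where $\gamma'_u=\gamma_u\left(c'/(4\pi^4)\right)^{|u|}$ with $c'=58/3$ for $\emptyset\ne u\subseteq 1:s$, and $\boldsymbol{\gamma}'^{1/2}=(\gamma_u'^{1/2})_{u\subseteq 1:s}$.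
   Context: $\mathbb{N}$ is the set of positive integers, $1:s=\{1,\ldots,s\}$. For a reproducing kernel $K:[0,1]^s\times[0,1]^s\to\mathbb{R}$, $\mathcal{H}(K)$ is the reproducing kernel Hilbert space of real-valued functions with kernel $K$. Point sets are finite multisets (multiplicity counts). For a finite multiset $P\subset[0,1]^s$ and a normed function space $V$, the worst-case error is $$e^{\mathrm{wor}}(P;V)=\sup_{f\in V,\ \|f\|_V\le 1}\left|\frac{1}{|P|}\sum_{\boldsymbol{x}\in P}f(\boldsymbol{x})-\int_{[0,1]^s}f(\boldsymbol{x})\,d\boldsymbol{x}\right|.$$ The rank-1 lattice point set is $P_{N,\boldsymbol{z}}=\{\{n\boldsymbol{z}/N\} : 0\le n<N\}$ (componentwise fractional parts; $N$ points with multiplicity). With the tent transformation $\phi(x)=1-|2x-1|$ applied componentwise, $P_{N,\boldsymbol{z}}^{\phi}=\{\phi(\boldsymbol{x}):\boldsymbol{x}\in P_{N,\boldsymbol{z}}\}$ (as a multiset of $N$ points). For non-empty $u\subseteq 1:s$, $$P_{N,\boldsymbol{z}}^{\perp,u}=\left\{\boldsymbol{k}_u=(k_j)_{j\in u}\in(\mathbb{Z}\setminus\{0\})^{|u|} : \sum_{j\in u}k_jz_j\equiv 0\pmod N\right\}.$$ Sobolev kernel: with $B_\tau$ the Bernoulli polynomial of degree $\tau$, $$K_{2,\boldsymbol{\gamma},s}^{\mathrm{sob}}(\boldsymbol{x},\boldsymbol{y})=1+\sum_{\emptyset\ne u\subseteq 1:s}\gamma_u\prod_{j\in u}\left[B_1(x_j)B_1(y_j)+\frac{B_2(x_j)B_2(y_j)}{4}-\frac{B_4(|x_j-y_j|)}{24}\right].$$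 Korobov kernel: for weights $\boldsymbol{\eta}=(\eta_u)_{u\subseteq 1:s}$, $\eta_u\ge 0$, and $\beta>1/2$, $$K_{\beta,\boldsymbol{\eta},s}^{\mathrm{kor}}(\boldsymbol{x},\boldsymbol{y})=1+\sum_{\emptyset\ne u\subseteq 1:s}\eta_u\prod_{j\in u}\sum_{h_j\in\mathbb{Z}\setminus\{0\}}\frac{e^{2\pi\mathrm{i}h_j(x_j-y_j)}}{|h_j|^{2\beta}}.$$ (The weight for $u=\emptyset$ plays no role in the kernels.) *)

theory Defs
  imports "HOL-Analysis.Analysis" "HOL-Library.Multiset" "HOL-Number_Theory.Cong"
    "HOL-Computational_Algebra.Polynomial"
begin

text \<open>
  Throughout, the dimension \<open>s\<close> is \<open>CARD('s)\<close> for a finite index type \<open>'s\<close>: points of the unit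
  cube are vectors \<open>x :: real ^ 's\<close> in \<open>cbox 0 1\<close>, the index set \<open>1:s\<close> is \<open>UNIV :: 's set\<close>, and
  weights are functions \<open>'s set \<Rightarrow> real\<close>.
\<close>


section \<open>Reproducing kernel Hilbert spaces\<close>

text \<open>
  Real-valued functions on \<open>X :: 'a set\<close> are represented by total functions that vanish outside
  \<open>X\<close>, so that equality of representatives is equality on \<open>X\<close> and the representatives are closed
  under pointwise linear operations.
  \<open>rkhs X K H ip\<close> says that the set \<open>H\<close> of functions on \<open>X\<close> with the inner product \<open>ip\<close> is the
  reproducing kernel Hilbert space with kernel \<open>K\<close> on \<open>X\<close>; for given \<open>X\<close> and \<open>K\<close>, it determines \<open>H\<close>
  and the values of \<open>ip\<close> on \<open>H\<close>. Nothing is said about \<open>ip\<close> outside of \<open>H\<close>, nor about \<open>K\<close> outside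
  of \<open>X\<close>.
\<close>

definition rkhs_norm :: "(('a \<Rightarrow> real) \<Rightarrow> ('a \<Rightarrow> real) \<Rightarrow> real) \<Rightarrow> ('a \<Rightarrow> real) \<Rightarrow> real" where
  "rkhs_norm ip f = sqrt (ip f f)"

definition kernel_section :: "'a set \<Rightarrow> ('a \<Rightarrow> 'a \<Rightarrow> real) \<Rightarrow> 'a \<Rightarrow> 'a \<Rightarrow> real" where
  "kernel_section X K y = (\<lambda>x. if x \<in> X then K x y else 0)"

locale rkhs =
  fixes X :: "'a set"
    and K :: "'a \<Rightarrow> 'a \<Rightarrow> real"
    and H :: "('a \<Rightarrow> real) set"
    and ip :: "('a \<Rightarrow> real) \<Rightarrow> ('a \<Rightarrow> real) \<Rightarrow> real"
  assumes vanish_outside: "f \<in> H \<Longrightarrow> x \<notin> X \<Longrightarrow> f x = 0"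
    and zero_mem: "(\<lambda>x. 0) \<in> H"
    and add_mem: "f \<in> H \<Longrightarrow> g \<in> H \<Longrightarrow> (\<lambda>x. f x + g x) \<in> H"
    and scale_mem: "f \<in> H \<Longrightarrow> (\<lambda>x. c * f x) \<in> H"
    and ip_commute: "f \<in> H \<Longrightarrow> g \<in> H \<Longrightarrow> ip f g = ip g f"
    and ip_add_left: "f \<in> H \<Longrightarrow> g \<in> H \<Longrightarrow> h \<in> H \<Longrightarrow> ip (\<lambda>x. f x + g x) h = ip f h + ip g h"
    and ip_scale_left: "f \<in> H \<Longrightarrow> g \<in> H \<Longrightarrow> ip (\<lambda>x. c * f x) g = c * ip f g"
    and ip_nonneg: "f \<in> H \<Longrightarrow> 0 \<le> ip f f"
    and ip_definite: "f \<in> H \<Longrightarrow> ip f f = 0 \<Longrightarrow> f = (\<lambda>x. 0)"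
    and complete: "(\<And>n. F n \<in> H) \<Longrightarrow>
          (\<forall>e>0. \<exists>M. \<forall>m\<ge>M. \<forall>n\<ge>M. rkhs_norm ip (\<lambda>x. F m x - F n x) < e) \<Longrightarrow>
          \<exists>f\<in>H. (\<lambda>n::nat. rkhs_norm ip (\<lambda>x. F n x - f x)) \<longlonglongrightarrow> 0"
    and kernel_mem: "y \<in> X \<Longrightarrow> kernel_section X K y \<in> H"
    and reproducing: "f \<in> H \<Longrightarrow> y \<in> X \<Longrightarrow> ip f (kernel_section X K y) = f y"


section \<open>Worst-case error\<close>

text \<open>
  \<open>V\<close> is the set of functions of the normed space and \<open>nrm\<close> its norm. The supremum is taken in
  \<open>[0, \<infinity>]\<close>, so that it has its usual meaning also when the integration errors are unbounded.
\<close>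

definition worst_case_error ::
  "(real ^ 's) multiset \<Rightarrow> (real ^ 's \<Rightarrow> real) set \<Rightarrow> ((real ^ 's \<Rightarrow> real) \<Rightarrow> real) \<Rightarrow> ennreal" where
  "worst_case_error P V nrm =
     (SUP f \<in> {f \<in> V. nrm f \<le> 1}.
        ennreal \<bar>1 / real (size P) * (\<Sum>x\<in>#P. f x) - integral (cbox 0 1) f\<bar>)"


section \<open>Lattice point sets\<close>

definition lattice_points :: "nat \<Rightarrow> nat ^ 's \<Rightarrow> (real ^ 's) multiset" where
  "lattice_points N z =
     image_mset (\<lambda>n. \<chi> j. frac (real n * real (z $ j) / real N)) (mset_set {0..<N})"

definition tent :: "real \<Rightarrow> real" where
  "tent x = 1 - \<bar>2 * x - 1\<bar>"

definition tent_lattice_points :: "nat \<Rightarrow> nat ^ 's \<Rightarrow> (real ^ 's) multiset" where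
  "tent_lattice_points N z = image_mset (\<lambda>x. \<chi> j. tent (x $ j)) (lattice_points N z)"

definition dual_lattice :: "nat \<Rightarrow> nat ^ 's \<Rightarrow> 's set \<Rightarrow> ('s \<Rightarrow> int) set" where
  "dual_lattice N z u =
     {k \<in> u \<rightarrow>\<^sub>E (UNIV - {0}). [(\<Sum>j\<in>u. k j * int (z $ j)) = 0] (mod int N)}"


section \<open>Kernels\<close>

text \<open>Bernoulli numbers, with the convention that the one of index 1 is \<open>- 1 / 2\<close>.\<close>

fun bernoulli_number :: "nat \<Rightarrow> real" where
  "bernoulli_number n =
     (if n = 0 then 1
      else - (\<Sum>k<n. real (Suc n choose k) * bernoulli_number k) / real (Suc n))"

declare bernoulli_number.simps [simp del]

definition bernoulli_poly :: "nat \<Rightarrow> real poly" where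
  "bernoulli_poly n = (\<Sum>k\<le>n. monom (real (n choose k) * bernoulli_number k) (n - k))"

definition sobolev_kernel :: "('s::finite set \<Rightarrow> real) \<Rightarrow> real ^ 's \<Rightarrow> real ^ 's \<Rightarrow> real" where
  "sobolev_kernel \<gamma> x y =
     1 + (\<Sum>u \<in> UNIV - {{}}. \<gamma> u * (\<Prod>j\<in>u.
           poly (bernoulli_poly 1) (x $ j) * poly (bernoulli_poly 1) (y $ j)
         + poly (bernoulli_poly 2) (x $ j) * poly (bernoulli_poly 2) (y $ j) / 4
         - poly (bernoulli_poly 4) \<bar>x $ j - y $ j\<bar> / 24))"

text \<open>
  The one-dimensional Korobov sum has a real value, because the terms for \<open>h\<close> and \<open>- h\<close> are
  complex conjugates; the real part below is only a change of type.
\<close>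

definition korobov_sum :: "real \<Rightarrow> real \<Rightarrow> real" where
  "korobov_sum \<beta> t =
     Re (\<Sum>\<^sub>\<infinity>h \<in> UNIV - {0::int}.
           exp (2 * complex_of_real pi * \<i> * of_int h * complex_of_real t)
           / complex_of_real (\<bar>real_of_int h\<bar> powr (2 * \<beta>)))"

definition korobov_kernel ::
  "real \<Rightarrow> ('s::finite set \<Rightarrow> real) \<Rightarrow> real ^ 's \<Rightarrow> real ^ 's \<Rightarrow> real" where
  "korobov_kernel \<beta> \<eta> x y =
     1 + (\<Sum>u \<in> UNIV - {{}}. \<eta> u * (\<Prod>j\<in>u. korobov_sum \<beta> (x $ j - y $ j)))"

end

theory Submission
  imports Defs
begin

text \<open>
  Both kernels have the form 1 + sum over u of weighted products of a one-dimensional factor whose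
  integral in one variable vanishes. Hence the integral is represented by the constant function 1
  and the squared worst-case error is the mean of the kernel over all pairs of points, minus 1.

  The tent transformation turns cos (pi k x) into cos (2 pi k x), so the transformed Sobolev factor
  is a double Fourier series with frequencies (k, l), both nonzero. Averaging over the lattice keeps
  exactly the frequencies in the dual lattice. The first inequality therefore only needs that the
  coefficients are at most (29 / 6) / (pi^4 k^2 l^2) in absolute value, where
  29 / (6 pi^4) = c' / (4 pi^4). For the Korobov kernel the same averaging is an exact
  evaluation, and the second inequality is that a sum of squares of nonnegative reals is at most the
  square of the sum.
\<close>

section \<open>Reproducing kernel Hilbert spaces\<close>

text \<open>The obstacle is a bound on all mixed coefficients \<open>(k, l)\<close> at once, for a
  kernel that combines \<open>B_1\<close>, \<open>B_2\<close> and \<open>B_4(|x - y|)\<close>. It is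
  overcome by writing the kernel as a Gram kernel: \<open>B_1(x) B_1(y)\<close> plus the L2 inner
  product of \<open>green x\<close> and \<open>green y\<close>. Each coefficient is then an inner
  product in R x L2[0,1] and is controlled by the diagonal ones. As a function of \<open>x\<close>,
  \<open>green x t\<close> has mean zero, equal values at 0 and 1, and second derivative minus the
  point mass at \<open>t\<close>; this determines its form. The constant is 29/6 = 4 + 1/2 + 1/3:
  for odd \<open>k\<close>, 4 comes from \<open>B_1\<close>, while 1/2 and 1/3 are the mean squares
  of \<open>cos (pi k t)\<close> and \<open>2 t - 1\<close>, whose cross term is negative. Only one
  Fourier expansion is proved from scratch, that of \<open>B_2\<close> at half the argument.
  \<open>B_1\<close>, \<open>B_2\<close>, \<open>green\<close> and the Korobov sum are combinations
  of its shifts and reflections. The Hilbert spaces are given only by their axioms, so continuity of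
  their members and boundedness of the integral must be extracted from the kernel.\<close>

context rkhs
begin

lemma ip_scale_right: "f \<in> H \<Longrightarrow> g \<in> H \<Longrightarrow> ip g (\<lambda>x. c * f x) = c * ip g f"
  using ip_scale_left[of f g c] ip_commute scale_mem by metis

lemma diff_mem: "f \<in> H \<Longrightarrow> g \<in> H \<Longrightarrow> (\<lambda>x. f x - g x) \<in> H"
  using add_mem[of f "\<lambda>x. -1 * g x"] scale_mem[of g "-1"] by simp

lemma ip_diff_left:
  assumes "f \<in> H" "g \<in> H" "h \<in> H"
  shows "ip (\<lambda>x. f x - g x) h = ip f h - ip g h"
  using ip_add_left[of f "\<lambda>x. -1 * g x" h] scale_mem[of g "-1"] ip_scale_left[of g h "-1"] assms
  by simp

lemma ip_diff_right:
  assumes "f \<in> H" "g \<in> H" "h \<in> H"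
  shows "ip h (\<lambda>x. f x - g x) = ip h f - ip h g"
  using ip_diff_left[OF assms] ip_commute assms diff_mem by metis

lemma sum_mem:
  assumes "finite I" "\<And>i. i \<in> I \<Longrightarrow> F i \<in> H"
  shows "(\<lambda>x. \<Sum>i\<in>I. c i * F i x) \<in> H"
  using assms
proof (induction I rule: finite_induct)
  case (insert i I)
  then have "(\<lambda>x. c i * F i x + (\<Sum>i\<in>I. c i * F i x)) \<in> H"
    by (intro add_mem scale_mem) auto
  then show ?case using insert by simp
qed (simp add: zero_mem)

lemma ip_zero_left: "g \<in> H \<Longrightarrow> ip (\<lambda>x. 0) g = 0"
  using ip_scale_left[of "\<lambda>x. 0" g 0] zero_mem by simp

lemma ip_sum_left:
  assumes "finite I" "\<And>i. i \<in> I \<Longrightarrow> F i \<in> H" "g \<in> H"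
  shows "ip (\<lambda>x. \<Sum>i\<in>I. c i * F i x) g = (\<Sum>i\<in>I. c i * ip (F i) g)"
  using assms
proof (induction I rule: finite_induct)
  case (insert i I)
  have "ip (\<lambda>x. c i * F i x + (\<Sum>i\<in>I. c i * F i x)) g
      = ip (\<lambda>x. c i * F i x) g + ip (\<lambda>x. \<Sum>i\<in>I. c i * F i x) g"
    using insert by (intro ip_add_left scale_mem sum_mem) auto
  then show ?case using insert by (simp add: ip_scale_left)
qed (simp add: ip_zero_left)

lemma ip_sum_right:
  assumes "finite I" "\<And>i. i \<in> I \<Longrightarrow> F i \<in> H" "g \<in> H"
  shows "ip g (\<lambda>x. \<Sum>i\<in>I. c i * F i x) = (\<Sum>i\<in>I. c i * ip g (F i))"
  using ip_sum_left[of I F g c] assms ip_commute sum_mem[of I F c] by simp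

lemma norm_nonneg: "f \<in> H \<Longrightarrow> 0 \<le> rkhs_norm ip f"
  by (simp add: rkhs_norm_def ip_nonneg)

lemma norm_power2: "f \<in> H \<Longrightarrow> rkhs_norm ip f ^ 2 = ip f f"
  by (simp add: rkhs_norm_def ip_nonneg)

lemma Cauchy_Schwarz:
  assumes f: "f \<in> H" and g: "g \<in> H"
  shows "\<bar>ip f g\<bar> \<le> rkhs_norm ip f * rkhs_norm ip g"
proof -
  have *: "0 \<le> ip f f - 2 * t * ip f g + t\<^sup>2 * ip g g" for t
  proof -
    have tg: "(\<lambda>x. t * g x) \<in> H" by (rule scale_mem[OF g])
    have "ip (\<lambda>x. f x - t * g x) (\<lambda>x. f x - t * g x) = ip f f - 2 * t * ip f g + t\<^sup>2 * ip g g"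
      using f g tg diff_mem[OF f tg] ip_commute[OF f g]
      by (simp add: ip_diff_left ip_diff_right ip_scale_left ip_scale_right power2_eq_square algebra_simps)
    then show ?thesis using ip_nonneg[OF diff_mem[OF f tg]] by simp
  qed
  have "(ip f g)\<^sup>2 \<le> ip f f * ip g g"
  proof (cases "ip g g = 0")
    case True
    then have "g = (\<lambda>x. 0)" using ip_definite g by blast
    then have "ip f g = 0" using ip_zero_left f zero_mem ip_commute by metis
    then show ?thesis using True by simp
  next
    case False
    then have pos: "ip g g > 0" using ip_nonneg[OF g] by simp
    have "0 \<le> ip f f - (ip f g)\<^sup>2 / ip g g"
      using *[of "ip f g / ip g g"] pos by (simp add: power2_eq_square field_simps)
    then show ?thesis using pos by (simp add: field_simps)
  qed
  then have "sqrt ((ip f g)\<^sup>2) \<le> sqrt (ip f f * ip g g)" by (rule real_sqrt_le_mono)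
  then show ?thesis by (simp add: rkhs_norm_def real_sqrt_mult)
qed

lemma kernel_eq_ip:
  assumes "x \<in> X" "y \<in> X"
  shows "ip (kernel_section X K y) (kernel_section X K x) = K x y"
  using reproducing[OF kernel_mem[OF assms(2)] assms(1)] assms by (simp add: kernel_section_def)

lemma kernel_commute: "x \<in> X \<Longrightarrow> y \<in> X \<Longrightarrow> K x y = K y x"
  using kernel_eq_ip ip_commute kernel_mem by metis

end

section \<open>Riemann sums and the representer of the integral\<close>

text \<open>The error depends on \<open>f\<close> only through its oscillation at scale
  \<open>d\<close>. A single tagged division therefore serves a whole equicontinuous family, such as
  all functions \<open>K x\<close>.\<close>

lemma tagged_sum_integral_bound:
  fixes f :: "'a::euclidean_space \<Rightarrow> real"
  assumes f: "continuous_on (cbox a b) f"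
    and p: "p tagged_division_of cbox a b" "(\<lambda>x. ball x d) fine p"
    and d: "\<And>x y. x \<in> cbox a b \<Longrightarrow> y \<in> cbox a b \<Longrightarrow> dist x y < d \<Longrightarrow> \<bar>f x - f y\<bar> \<le> e"
  shows "\<bar>(\<Sum>t\<in>p. measure lborel (snd t) * f (fst t)) - integral (cbox a b) f\<bar> \<le> e * measure lborel (cbox a b)"
proof -
  have int: "f integrable_on cbox a b" by (rule integrable_continuous[OF f])
  have "(\<Sum>t\<in>p. measure lborel (snd t) * f (fst t)) - integral (cbox a b) f
      = (\<Sum>t\<in>p. measure lborel (snd t) * f (fst t) - integral (snd t) f)"
    by (simp add: integral_combine_tagged_division_topdown[OF int p(1)] sum_subtractf case_prod_beta)
  also have "\<bar>\<dots>\<bar> \<le> (\<Sum>t\<in>p. e * measure lborel (snd t))"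
  proof (rule order_trans[OF sum_abs sum_mono])
    fix t assume "t \<in> p"
    then obtain x k where t: "t = (x, k)" "(x, k) \<in> p" by (cases t) auto
    obtain u v where k: "k = cbox u v" "x \<in> k" "k \<subseteq> cbox a b"
      using tagged_division_ofD(2,3,4)[OF p(1) t(2)] by auto
    have sub: "k \<subseteq> ball x d" using p(2) t(2) by (auto simp: fine_def)
    have fk: "f integrable_on cbox u v" using integrable_on_subcbox[OF int] k by simp
    have e: "0 \<le> e" using d[of x x] k sub by force
    have "((\<lambda>y. f x - f y) has_integral (measure lborel k * f x - integral k f)) (cbox u v)"
      using has_integral_diff[OF has_integral_const[of "f x" u v] integrable_integral[OF fk]] k by simp
    then have "norm (measure lborel k * f x - integral k f) \<le> e * measure lborel (cbox u v)"
    proof (rule has_integral_bound[OF e])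
      fix y assume "y \<in> cbox u v"
      then have "x \<in> cbox a b" "y \<in> cbox a b" "dist x y < d" using k sub by auto
      then show "norm (f x - f y) \<le> e" using d by simp
    qed
    then show "\<bar>measure lborel (snd t) * f (fst t) - integral (snd t) f\<bar> \<le> e * measure lborel (snd t)"
      using t k by simp
  qed
  also have "\<dots> = e * measure lborel (cbox a b)"
    using additive_content_tagged_division[OF p(1)]
    by (simp add: sum_distrib_left[symmetric] case_prod_beta)
  finally show ?thesis .
qed

text \<open>\<open>K x x - 2 * K x y + K y y\<close> is the squared distance between the kernel
  sections at \<open>x\<close> and \<open>y\<close>, so Cauchy-Schwarz transfers its convergence to
  every member of \<open>H\<close>. The index type carries no topology here; \<open>F x\<close>
  stands for a filter such as \<open>at x within X\<close>.\<close>

lemma (in rkhs) tendsto_mem: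
  assumes cont: "\<And>x. x \<in> X \<Longrightarrow> ((\<lambda>y. K x x - 2 * K x y + K y y) \<longlongrightarrow> 0) (F x)"
    and F: "\<And>x. x \<in> X \<Longrightarrow> eventually (\<lambda>y. y \<in> X) (F x)"
    and f: "f \<in> H" and x: "x \<in> X"
  shows "(f \<longlongrightarrow> f x) (F x)"
proof -
  have lim: "((\<lambda>y. rkhs_norm ip f * sqrt (K x x - 2 * K x y + K y y)) \<longlongrightarrow> rkhs_norm ip f * sqrt 0) (F x)"
    by (intro tendsto_intros cont x)
  have bound: "\<bar>f y - f x\<bar> \<le> rkhs_norm ip f * sqrt (K x x - 2 * K x y + K y y)" if y: "y \<in> X" for y
  proof -
    let ?S = "kernel_section X K"
    have m: "?S x \<in> H" "?S y \<in> H" using kernel_mem x y by auto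
    have d: "(\<lambda>z. ?S y z - ?S x z) \<in> H" using diff_mem m by blast
    have "f y - f x = ip f (\<lambda>z. ?S y z - ?S x z)"
      using m f x y by (simp add: ip_diff_right reproducing)
    moreover have "ip (\<lambda>z. ?S y z - ?S x z) (\<lambda>z. ?S y z - ?S x z) = K x x - 2 * K x y + K y y"
      using m d x y kernel_commute[OF x y] by (simp add: ip_diff_left ip_diff_right kernel_eq_ip)
    ultimately show ?thesis using Cauchy_Schwarz[OF f d] by (simp add: rkhs_norm_def)
  qed
  have "((\<lambda>y. f y - f x) \<longlongrightarrow> 0) (F x)"
  proof (rule Lim_null_comparison)
    show "\<forall>\<^sub>F y in F x. norm (f y - f x) \<le> rkhs_norm ip f * sqrt (K x x - 2 * K x y + K y y)"
      by (rule eventually_mono[OF F[OF x]]) (simp add: bound)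
  qed (use lim in simp)
  then show ?thesis by (simp add: LIM_zero_iff)
qed

text \<open>
  The integral is represented by the limit of Riemann sums of kernel sections, so that no Riesz
  representation theorem is needed.
\<close>

lemma
  fixes K :: "'a::euclidean_space \<Rightarrow> 'a \<Rightarrow> real"
  assumes rkhs: "rkhs (cbox a b) K H ip"
    and cont: "continuous_on (cbox a b \<times> cbox a b) (\<lambda>(x, y). K x y)"
    and one: "\<And>x. x \<in> cbox a b \<Longrightarrow> integral (cbox a b) (K x) = 1"
  shows rkhs_const_mem: "(indicat_real (cbox a b)) \<in> H"
    and rkhs_ip_const: "\<And>f. f \<in> H \<Longrightarrow> ip f (indicat_real (cbox a b)) = integral (cbox a b) f"
proof -
  interpret rkhs "cbox a b" K H ip by (rule rkhs)
  define X where "X = cbox a b"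
  define C where "C = measure lborel X"
  define S where "S = kernel_section X K"
  have S: "S y \<in> H" if "y \<in> X" for y using kernel_mem that by (simp add: S_def X_def)
  have Sip: "ip f (S y) = f y" if "y \<in> X" "f \<in> H" for y f
    using reproducing that by (simp add: S_def X_def)
  have SK: "S y x = K x y" if "x \<in> X" for x y using that by (simp add: S_def kernel_section_def)
  have "\<exists>p. p tagged_division_of X \<and> (\<lambda>x. ball x (1 / real (Suc n))) fine p" for n
    using fine_division_exists[OF gauge_ball[of "1 / real (Suc n)"], of a b] unfolding X_def
    by (metis divide_pos_pos of_nat_0_less_iff zero_less_Suc zero_less_one)
  then obtain p where p: "\<And>n. p n tagged_division_of X"
    and fine: "\<And>n. (\<lambda>x. ball x (1 / real (Suc n))) fine p n" by metis
  have fin: "finite (p n)" for n using p by blast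
  have tag: "fst t \<in> X" if "t \<in> p n" for t n
    using tagged_division_ofD(2,3)[OF p, of "fst t" "snd t"] that by auto
  have total: "(\<Sum>t\<in>p n. measure lborel (snd t)) = C" for n
    using additive_content_tagged_division[OF p[unfolded X_def]]
    by (simp add: C_def X_def case_prod_beta)
  have C: "0 \<le> C" by (simp add: C_def)
  \<comment> \<open>The index \<open>M\<close> is common to all of \<open>G\<close> because the
    modulus \<open>d\<close> is. \<open>conv\<close> needs this for a single function,
    \<open>closeK\<close> for all \<open>K x\<close> together.\<close>
  have close: "\<exists>M. \<forall>n\<ge>M. \<forall>g\<in>G. \<bar>(\<Sum>t\<in>p n. measure lborel (snd t) * g (fst t)) - integral X g\<bar> \<le> e * C"
    if e: "e > 0" and G: "\<And>g. g \<in> G \<Longrightarrow> continuous_on X g" 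
      and d: "d > 0" "\<And>g x y. g \<in> G \<Longrightarrow> x \<in> X \<Longrightarrow> y \<in> X \<Longrightarrow> dist x y < d \<Longrightarrow> \<bar>g x - g y\<bar> \<le> e" for e d G
  proof -
    obtain M where M: "inverse (real (Suc M)) < d" using reals_Archimedean[OF d(1)] by blast
    show ?thesis
    proof (intro exI allI impI ballI)
      fix n g assume n: "M \<le> n" and g: "g \<in> G"
      have "1 / real (Suc n) \<le> inverse (real (Suc M))" using n by (simp add: divide_simps)
      then have "1 / real (Suc n) < d" using M by simp
      then show "\<bar>(\<Sum>t\<in>p n. measure lborel (snd t) * g (fst t)) - integral X g\<bar> \<le> e * C"
        unfolding X_def C_def
        using tagged_sum_integral_bound[OF G[OF g, unfolded X_def] p[unfolded X_def] fine, of n e]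
          d(2)[OF g, unfolded X_def] by simp
    qed
  qed
  have conv: "(\<lambda>n. \<Sum>t\<in>p n. measure lborel (snd t) * g (fst t)) \<longlonglongrightarrow> integral X g"
    if g: "continuous_on X g" for g
  proof (rule LIMSEQ_I)
    fix r :: real assume r: "0 < r"
    define e where "e = r / (C + 1)"
    have e: "e > 0" "e * C < r" using r C by (auto simp: e_def divide_simps)
    have "uniformly_continuous_on X g"
      using g compact_uniformly_continuous by (metis X_def compact_cbox)
    then obtain d where d: "d > 0" "\<And>x y. x \<in> X \<Longrightarrow> y \<in> X \<Longrightarrow> dist x y < d \<Longrightarrow> \<bar>g x - g y\<bar> < e"
      using e unfolding uniformly_continuous_on_def dist_real_def by (metis dist_commute)
    have "\<exists>M. \<forall>n\<ge>M. \<forall>g\<in>{g}. \<bar>(\<Sum>t\<in>p n. measure lborel (snd t) * g (fst t)) - integral X g\<bar> \<le> e * C"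
      by (rule close[OF e(1) _ d(1)]) (use g d(2) in \<open>auto intro: less_imp_le\<close>)
    then show "\<exists>no. \<forall>n\<ge>no. norm ((\<Sum>t\<in>p n. measure lborel (snd t) * g (fst t)) - integral X g) < r"
      using e(2) by fastforce
  qed
  have contK: "continuous_on X (K x)" if "x \<in> X" for x
    by (rule continuous_on_compose2[OF cont, of X "\<lambda>y. (x, y)", simplified])
       (use that in \<open>auto intro!: continuous_intros simp: X_def\<close>)
  \<comment> \<open>Uniform continuity of \<open>K\<close> on the compact square gives one modulus
    for all \<open>x\<close>.\<close>
  have closeK: "\<exists>M. \<forall>n\<ge>M. \<forall>x\<in>X. \<bar>(\<Sum>t\<in>p n. measure lborel (snd t) * K x (fst t)) - 1\<bar> \<le> e * C"
    if e: "e > 0" for e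
  proof -
    have "uniformly_continuous_on (X \<times> X) (\<lambda>(x, y). K x y)"
      using compact_uniformly_continuous[OF cont compact_Times[OF compact_cbox compact_cbox]] by (simp add: X_def)
    then obtain d where d0: "d > 0" "\<And>s t. s \<in> X \<times> X \<Longrightarrow> t \<in> X \<times> X \<Longrightarrow> dist t s < d \<Longrightarrow>
        dist (case t of (x, y) \<Rightarrow> K x y) (case s of (x, y) \<Rightarrow> K x y) < e"
      using uniformly_continuous_onE[OF _ e] by blast
    have d: "\<bar>K x y - K x y'\<bar> \<le> e" if "x \<in> X" "y \<in> X" "y' \<in> X" "dist y y' < d" for x y y'
      using d0(2)[of "(x, y')" "(x, y)"] that by (simp add: dist_Pair_Pair dist_real_def)
    have "\<exists>M. \<forall>n\<ge>M. \<forall>g\<in>K ` X. \<bar>(\<Sum>t\<in>p n. measure lborel (snd t) * g (fst t)) - integral X g\<bar> \<le> e * C"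
      by (rule close[OF e _ d0(1)]) (use contK d in auto)
    then show ?thesis using one by (simp add: X_def)
  qed
  \<comment> \<open>A Riemann sum of the \<open>H\<close>-valued map sending \<open>y\<close> to its
    kernel section; its limit must represent integration.\<close>
  define h where "h n = (\<lambda>x. \<Sum>t\<in>p n. measure lborel (snd t) * S (fst t) x)" for n
  have h: "h n \<in> H" for n unfolding h_def by (intro sum_mem fin S tag)
  have iph: "ip f (h n) = (\<Sum>t\<in>p n. measure lborel (snd t) * f (fst t))" if "f \<in> H" for f n
    unfolding h_def using that by (subst ip_sum_right) (auto simp: fin S tag Sip)
  have conth: "(\<lambda>n. ip f (h n)) \<longlonglongrightarrow> integral X f" if f: "f \<in> H" for f
  proof -
    have "continuous_on X f"
      unfolding continuous_on_def
    proof (rule ballI, rule tendsto_mem[OF _ _ f])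
      fix x assume x: "x \<in> cbox a b"
      have 1: "continuous_on X (\<lambda>y. K y y)"
        by (rule continuous_on_compose2[OF cont, of X "\<lambda>y. (y, y)", simplified])
           (auto intro!: continuous_intros simp: X_def)
      have "((\<lambda>y. K x x - 2 * K x y + K y y) \<longlongrightarrow> K x x - 2 * K x x + K x x) (at x within X)"
        using 1 contK[of x] x by (intro tendsto_intros) (auto simp: continuous_on_def X_def)
      then show "((\<lambda>y. K x x - 2 * K x y + K y y) \<longlongrightarrow> 0) (at x within X)" by simp
    qed (auto simp: X_def eventually_at_filter)
    then show ?thesis using conv iph[OF f] by simp
  qed
  \<comment> \<open>The inner product of two Riemann sums is a double Riemann sum of
    \<open>K\<close>. The sum belonging to \<open>m\<close> is within \<open>e * C\<close> of 1 at
    every point, and the weights belonging to \<open>n\<close> add up to \<open>C\<close>.\<close>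
  have iphh: "\<bar>ip (h m) (h n) - C\<bar> \<le> e * C * C"
    if "\<forall>x\<in>X. \<bar>(\<Sum>t\<in>p m. measure lborel (snd t) * K x (fst t)) - 1\<bar> \<le> e * C" for e m n
  proof -
    have "ip (h m) (h n) - C = (\<Sum>t\<in>p n. measure lborel (snd t) * (h m (fst t) - 1))"
      by (simp add: iph[OF h] sum_subtractf right_diff_distrib total)
    also have "\<bar>\<dots>\<bar> \<le> (\<Sum>t\<in>p n. measure lborel (snd t) * (e * C))"
    proof (rule order_trans[OF sum_abs sum_mono])
      fix t assume "t \<in> p n"
      then have "\<bar>h m (fst t) - 1\<bar> \<le> e * C" using that tag[of t n] by (simp add: h_def SK)
      then show "\<bar>measure lborel (snd t) * (h m (fst t) - 1)\<bar> \<le> measure lborel (snd t) * (e * C)"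
        by (simp add: abs_mult mult_left_mono)
    qed
    also have "\<dots> = e * C * C" unfolding sum_distrib_right[symmetric] total by simp
    finally show ?thesis .
  qed
  have "\<exists>f\<in>H. (\<lambda>n. rkhs_norm ip (\<lambda>x. h n x - f x)) \<longlonglongrightarrow> 0"
  proof (rule complete[OF h], intro allI impI)
    fix r :: real assume r: "0 < r"
    \<comment> \<open>The squared distance of \<open>h m\<close> and \<open>h n\<close> is a signed
      sum of four inner products, each within \<open>e * C * C\<close> of \<open>C\<close>, and the
      four copies of \<open>C\<close> cancel. The \<open>+ 1\<close> keeps the denominator positive
      when \<open>C = 0\<close>.\<close>
    define e where "e = r\<^sup>2 / (4 * C * C + 1)"
    have D: "4 * C * C + 1 > 0" using C by (simp add: add_nonneg_pos)
    have e0: "e > 0" using r D by (simp add: e_def)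
    have "e * (4 * C * C + 1) = r\<^sup>2" using D by (simp add: e_def)
    then have e: "e > 0" "4 * (e * C * C) < r\<^sup>2" using e0 by (simp_all add: algebra_simps)
    obtain M where M: "\<And>n. n \<ge> M \<Longrightarrow> \<forall>x\<in>X. \<bar>(\<Sum>t\<in>p n. measure lborel (snd t) * K x (fst t)) - 1\<bar> \<le> e * C"
      using closeK[OF e(1)] by blast
    show "\<exists>M. \<forall>m\<ge>M. \<forall>n\<ge>M. rkhs_norm ip (\<lambda>x. h m x - h n x) < r"
    proof (intro exI allI impI)
      fix m n assume mn: "M \<le> m" "M \<le> n"
      have "ip (\<lambda>x. h m x - h n x) (\<lambda>x. h m x - h n x) = ip (h m) (h m) - ip (h m) (h n) - (ip (h n) (h m) - ip (h n) (h n))"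
        using h[of m] h[of n] diff_mem[OF h h] by (simp add: ip_diff_left ip_diff_right)
      also have "\<dots> \<le> 4 * (e * C * C)"
        using abs_le_D1[OF iphh[OF M[OF mn(1)], of m]] abs_le_D2[OF iphh[OF M[OF mn(1)], of n]]
          abs_le_D2[OF iphh[OF M[OF mn(2)], of m]] abs_le_D1[OF iphh[OF M[OF mn(2)], of n]] by simp
      finally have "ip (\<lambda>x. h m x - h n x) (\<lambda>x. h m x - h n x) < r\<^sup>2" using e by linarith
      then show "rkhs_norm ip (\<lambda>x. h m x - h n x) < r"
        unfolding rkhs_norm_def using r real_sqrt_less_mono by fastforce
    qed
  qed
  then obtain l where l: "l \<in> H" "(\<lambda>n. rkhs_norm ip (\<lambda>x. h n x - l x)) \<longlonglongrightarrow> 0" by blast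
  have lim: "(\<lambda>n. ip f (h n)) \<longlonglongrightarrow> ip f l" if f: "f \<in> H" for f
  proof -
    have "(\<lambda>n. ip f (h n) - ip f l) \<longlonglongrightarrow> 0"
    proof (rule Lim_null_comparison)
      show "(\<lambda>n. rkhs_norm ip f * rkhs_norm ip (\<lambda>x. h n x - l x)) \<longlonglongrightarrow> 0"
        using tendsto_mult_left[OF l(2), of "rkhs_norm ip f"] by simp
      show "\<forall>\<^sub>F n in sequentially. norm (ip f (h n) - ip f l) \<le> rkhs_norm ip f * rkhs_norm ip (\<lambda>x. h n x - l x)"
        using Cauchy_Schwarz[OF f diff_mem[OF h l(1)]] h l(1) f by (simp add: ip_diff_right)
    qed
    then show ?thesis by (simp add: LIM_zero_iff)
  qed
  have eq: "ip f l = integral X f" if "f \<in> H" for f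
    using LIMSEQ_unique[OF lim[OF that] conth[OF that]] .
  \<comment> \<open>The limit is known only through its inner products. Pairing it with the section
    at \<open>x\<close> yields the integral of \<open>K x\<close>, which is 1.\<close>
  have "l = indicat_real (cbox a b)"
  proof
    fix x show "l x = indicat_real (cbox a b) x"
    proof (cases "x \<in> X")
      case True
      have "l x = ip (S x) l" using Sip[OF True l(1)] ip_commute[OF l(1) S[OF True]] by simp
      also have "\<dots> = integral X (S x)" by (rule eq[OF S[OF True]])
      also have "\<dots> = integral X (K x)"
        by (rule integral_cong) (use True kernel_commute in \<open>auto simp: SK X_def\<close>)
      finally show ?thesis using True one by (simp add: X_def)
    qed (use vanish_outside[OF l(1)] in \<open>auto simp: X_def\<close>)
  qed
  then show "indicat_real (cbox a b) \<in> H" "\<And>f. f \<in> H \<Longrightarrow> ip f (indicat_real (cbox a b)) = integral (cbox a b) f"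
    using l(1) eq by (auto simp: X_def)
qed

section \<open>Worst-case error of tensor product kernels\<close>

lemma integral_lborel_prod:
  fixes f :: "'a::euclidean_space \<Rightarrow> real \<Rightarrow> real"
  assumes f: "\<And>b. b \<in> Basis \<Longrightarrow> integrable lborel (f b)"
  shows "(\<integral>x. (\<Prod>b\<in>Basis. f b (x \<bullet> b)) \<partial>lborel) = (\<Prod>b\<in>Basis. \<integral>t. f b t \<partial>lborel)"
proof -
  interpret product_sigma_finite "\<lambda>_::'a. lborel :: real measure" ..
  have [measurable]: "f b \<in> borel_measurable borel" if "b \<in> Basis" for b
    using borel_measurable_integrable[OF f[OF that]] by simp
  have "(\<integral>x. (\<Prod>b\<in>Basis. f b (x \<bullet> b)) \<partial>lborel)
      = (\<integral>g. (\<Prod>b\<in>Basis. f b ((\<Sum>b\<in>Basis. g b *\<^sub>R b) \<bullet> b)) \<partial>(\<Pi>\<^sub>M b\<in>(Basis::'a set). lborel))"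
    by (subst lborel_eq, subst integral_distr) measurable
  also have "\<dots> = (\<integral>g. (\<Prod>b\<in>Basis. f b (g b)) \<partial>(\<Pi>\<^sub>M b\<in>(Basis::'a set). lborel))"
    by (intro Bochner_Integration.integral_cong prod.cong refl) simp
  also have "\<dots> = (\<Prod>b\<in>Basis. \<integral>t. f b t \<partial>lborel)"
    by (rule product_integral_prod) (auto intro: f)
  finally show ?thesis .
qed

lemma integral_unit_cube_prod:
  fixes f :: "'s::finite \<Rightarrow> real \<Rightarrow> real"
  assumes f: "\<And>j. continuous_on {0..1} (f j)"
  shows "integral (cbox 0 (1 :: real ^ 's)) (\<lambda>x. \<Prod>j\<in>UNIV. f j (x $ j)) = (\<Prod>j\<in>UNIV. integral {0..1} (f j))"
proof -
  \<comment> \<open>Fubini over \<open>Basis\<close> is indexed by vectors, so \<open>THE\<close>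
    recovers the coordinate from the axis vector. The indicator extends each factor by zero, so that
    the integral runs over the whole space.\<close>
  define g where "g b t = indicator {0..1} t *\<^sub>R f (THE j. b = axis j 1) t" for b :: "real ^ 's" and t
  have g_axis: "g (axis j 1) = (\<lambda>t. indicator {0..1} t *\<^sub>R f j t)" for j
    by (simp add: g_def axis_eq_axis fun_eq_iff)
  have prod: "(\<Prod>b\<in>Basis. h b) = (\<Prod>j\<in>UNIV. h (axis j 1))" for h :: "real ^ 's \<Rightarrow> real"
  proof -
    have B: "(Basis :: (real ^ 's) set) = range (\<lambda>j. axis j 1)" by (auto simp: Basis_vec_def)
    have "inj (\<lambda>j::'s. axis j (1::real))" by (auto intro!: injI simp: axis_eq_axis)
    from prod.reindex[OF this, of h] show ?thesis unfolding B by (simp add: o_def)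
  qed
  have g_int: "integrable lborel (g b)" if b: "b \<in> Basis" for b
  proof -
    obtain j where "b = axis j 1" using b by (auto simp: Basis_vec_def)
    then show ?thesis
      using borel_integrable_compact[OF compact_Icc f[of j]] by (simp add: g_axis)
  qed
  have cont: "continuous_on (cbox 0 (1 :: real ^ 's)) (\<lambda>x. \<Prod>j\<in>UNIV. f j (x $ j))"
    by (intro continuous_on_prod continuous_on_compose2[OF f]) (auto intro!: continuous_intros simp: mem_box_cart)
  then have si: "set_integrable lborel (cbox 0 (1 :: real ^ 's)) (\<lambda>x. \<Prod>j\<in>UNIV. f j (x $ j))"
    unfolding set_integrable_def by (intro borel_integrable_compact compact_cbox)
  have "integral (cbox 0 (1 :: real ^ 's)) (\<lambda>x. \<Prod>j\<in>UNIV. f j (x $ j))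
      = (\<integral>x. indicator (cbox 0 1) x *\<^sub>R (\<Prod>j\<in>UNIV. f j (x $ j)) \<partial>(lborel :: (real ^ 's) measure))"
    using set_borel_integral_eq_integral(2)[OF si] by (simp add: set_lebesgue_integral_def)
  also have "\<dots> = (\<integral>x. (\<Prod>b\<in>Basis. g b (x \<bullet> b)) \<partial>(lborel :: (real ^ 's) measure))"
  proof (rule Bochner_Integration.integral_cong[OF refl])
    fix x :: "real ^ 's"
    have "(\<Prod>j\<in>UNIV. indicat_real {0..1} (x $ j)) = indicat_real (cbox 0 1) x"
    proof (cases "x \<in> cbox 0 1")
      case False
      then obtain j where "x $ j \<notin> {0..1}" by (auto simp: mem_box_cart)
      then have "(\<Prod>j\<in>UNIV. indicat_real {0..1} (x $ j)) = 0"
        by (intro prod_zero bexI[of _ j]) auto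
      then show ?thesis using False by simp
    qed (auto simp: mem_box_cart)
    then show "indicat_real (cbox 0 1) x *\<^sub>R (\<Prod>j\<in>UNIV. f j (x $ j)) = (\<Prod>b\<in>Basis. g b (x \<bullet> b))"
      by (simp add: prod g_axis prod.distrib inner_axis)
  qed
  also have "\<dots> = (\<Prod>b\<in>Basis. \<integral>t. g b t \<partial>lborel)" by (rule integral_lborel_prod[OF g_int])
  also have "\<dots> = (\<Prod>j\<in>UNIV. integral {0..1} (f j))"
    unfolding prod
  proof (rule prod.cong[OF refl])
    fix j :: 's
    have "set_integrable lborel {0..1} (f j)" by (rule borel_integrable_atLeastAtMost'[OF f])
    then show "(\<integral>t. g (axis j 1) t \<partial>lborel) = integral {0..1} (f j)"
      using set_borel_integral_eq_integral(2)[of "{0..1}" "f j"] by (simp add: set_lebesgue_integral_def g_axis)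
  qed
  finally show ?thesis .
qed

lemma content_unit_cube: "measure lborel (cbox 0 (1 :: real ^ 's::finite)) = 1"
  by (simp add: content_cbox_if_cart interval_eq_empty_cart)

text \<open>The error functional has the representer \<open>r = q - u\<close>, where
  \<open>q\<close> is the mean of the kernel sections at the points and \<open>u\<close> represents
  the integral; the worst-case error is its dual norm. In the expansion of \<open>ip r r\<close>,
  both \<open>ip u q\<close> and \<open>ip u u\<close> are 1.\<close>

lemma worst_case_error_rkhs:
  fixes p :: "nat \<Rightarrow> real ^ 's::finite"
  assumes rkhs: "rkhs (cbox 0 1) K H ip"
    and cont: "continuous_on (cbox 0 1 \<times> cbox 0 1) (\<lambda>(x, y). K x y)"
    and one: "\<And>x. x \<in> cbox 0 1 \<Longrightarrow> integral (cbox 0 1) (K x) = 1"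
    and n: "n > 0" and p: "\<And>i. p i \<in> cbox 0 1"
  shows "(worst_case_error (image_mset p (mset_set {0..<n})) H (rkhs_norm ip))\<^sup>2
      = ennreal ((\<Sum>i<n. \<Sum>j<n. K (p i) (p j)) / (real n)\<^sup>2 - 1)" (is "?e\<^sup>2 = ennreal ?A")
proof -
  interpret rkhs "cbox 0 1" K H ip by (rule rkhs)
  define S where "S i = kernel_section (cbox 0 1) K (p i)" for i
  have S: "S i \<in> H" for i by (simp add: S_def kernel_mem p)
  define u where "u = indicat_real (cbox 0 (1 :: real ^ 's))"
  have u: "u \<in> H" "\<And>f. f \<in> H \<Longrightarrow> ip f u = integral (cbox 0 1) f"
    using rkhs_const_mem[OF rkhs cont one] rkhs_ip_const[OF rkhs cont one] by (auto simp: u_def)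
  define q where "q = (\<lambda>x. \<Sum>i<n. (1 / real n) * S i x)"
  have q: "q \<in> H" unfolding q_def by (intro sum_mem S) auto
  define r where "r = (\<lambda>x. q x - u x)"
  have r: "r \<in> H" unfolding r_def by (rule diff_mem[OF q u(1)])
  have ipq: "ip f q = 1 / real n * (\<Sum>i<n. f (p i))" if "f \<in> H" for f
    unfolding q_def using that
    by (subst ip_sum_right) (auto simp: S S_def reproducing p kernel_mem sum_divide_distrib)
  have ipr: "ip f r = 1 / real n * (\<Sum>i<n. f (p i)) - integral (cbox 0 1) f" if "f \<in> H" for f
    unfolding r_def using that q u by (simp add: ip_diff_right ipq)
  have qp: "q (p j) = 1 / real n * (\<Sum>i<n. K (p j) (p i))" for j
    using p by (simp add: q_def S_def kernel_section_def sum_divide_distrib)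
  have ipqq: "ip q q = (\<Sum>i<n. \<Sum>j<n. K (p i) (p j)) / (real n)\<^sup>2"
    by (simp add: ipq[OF q] qp sum_divide_distrib[symmetric] power2_eq_square)
  have ipuq: "ip u q = 1" using n p by (subst ipq[OF u(1)]) (simp add: u_def)
  have "ip u u = integral (cbox 0 1) u" using u by blast
  also have "\<dots> = integral (cbox 0 (1 :: real ^ 's)) (\<lambda>x. 1)"
    by (rule integral_cong) (simp add: u_def)
  also have "\<dots> = 1" by (simp add: content_unit_cube)
  finally have ipuu: "ip u u = 1" .
  have "ip r r = ip r q - ip r u" using r q u(1) unfolding r_def[symmetric] 
    by (subst (2) r_def) (simp add: ip_diff_right)
  also have "\<dots> = ip q q - ip u q - (ip q u - ip u u)"
    using q u(1) unfolding r_def by (simp add: ip_diff_left)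
  finally have rr: "ip r r = ?A" using ipqq ipuq ipuu ip_commute[OF q u(1)] by simp
  have err: "\<bar>1 / real (size (image_mset p (mset_set {0..<n}))) * (\<Sum>x\<in>#image_mset p (mset_set {0..<n}). f x)
      - integral (cbox 0 1) f\<bar> = \<bar>ip f r\<bar>" if "f \<in> H" for f
    using ipr[OF that] by (simp add: image_mset.compositionality sum_unfold_sum_mset[symmetric] o_def atLeast0LessThan)
  have "?e = ennreal (rkhs_norm ip r)"
  proof (rule antisym)
    show "?e \<le> ennreal (rkhs_norm ip r)"
      unfolding worst_case_error_def
    proof (rule SUP_least)
      fix f assume "f \<in> {f \<in> H. rkhs_norm ip f \<le> 1}"
      then have f: "f \<in> H" "rkhs_norm ip f \<le> 1" by auto
      have "\<bar>ip f r\<bar> \<le> rkhs_norm ip f * rkhs_norm ip r" by (rule Cauchy_Schwarz[OF f(1) r])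
      also have "\<dots> \<le> rkhs_norm ip r" using f(2) norm_nonneg[OF r] by (simp add: mult_left_le_one_le norm_nonneg f)
      finally show "ennreal \<bar>1 / real (size (image_mset p (mset_set {0..<n}))) * (\<Sum>x\<in>#image_mset p (mset_set {0..<n}). f x)
      - integral (cbox 0 1) f\<bar> \<le> ennreal (rkhs_norm ip r)"
        unfolding err[OF f(1)] by (rule ennreal_leI)
    qed
    show "ennreal (rkhs_norm ip r) \<le> ?e"
    proof (cases "rkhs_norm ip r = 0")
      case False
      then have nr: "rkhs_norm ip r > 0" using norm_nonneg[OF r] by simp
      \<comment> \<open>The supremum is attained at the normalised representer.\<close>
      define f where "f = (\<lambda>x. inverse (rkhs_norm ip r) * r x)"
      have f: "f \<in> H" unfolding f_def by (rule scale_mem[OF r])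
      have rr0: "ip r r > 0" using norm_power2[OF r] nr by (metis zero_less_power)
      have "ip f f = 1" "ip f r = rkhs_norm ip r"
        using rr0 norm_power2[OF r] nr f[unfolded f_def] r unfolding f_def
        by (simp_all add: ip_scale_left ip_scale_right power2_eq_square)
           (simp_all add: divide_simps)
      then have f1: "f \<in> {f \<in> H. rkhs_norm ip f \<le> 1}" and "\<bar>ip f r\<bar> = rkhs_norm ip r"
        using f nr by (simp_all add: rkhs_norm_def)
      then show ?thesis
        unfolding worst_case_error_def by (intro SUP_upper2[OF f1]) (simp only: err[OF f] order_refl)
    qed simp
  qed
  then show "?e\<^sup>2 = ennreal ?A"
    by (simp add: ennreal_power norm_nonneg[OF r] norm_power2[OF r] rr)
qed

lemma worst_case_error_tensor_kernel:
  fixes p :: "nat \<Rightarrow> real ^ 's::finite" and \<eta> :: "'s set \<Rightarrow> real"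
  assumes rkhs: "rkhs (cbox 0 1) K H ip"
    and K: "\<And>x y. x \<in> cbox 0 1 \<Longrightarrow> y \<in> cbox 0 1 \<Longrightarrow>
        K x y = 1 + (\<Sum>u \<in> UNIV - {{}}. \<eta> u * (\<Prod>j\<in>u. \<kappa> (x $ j) (y $ j)))"
    and cont: "continuous_on ({0..1} \<times> {0..1}) (\<lambda>(s, t). \<kappa> s t)"
    and zero: "\<And>s. s \<in> {0..1} \<Longrightarrow> integral {0..1} (\<kappa> s) = 0"
    and n: "n > 0" and p: "\<And>i. p i \<in> cbox 0 1"
  shows "(worst_case_error (image_mset p (mset_set {0..<n})) H (rkhs_norm ip))\<^sup>2
      = ennreal (\<Sum>u \<in> UNIV - {{}}. \<eta> u * ((\<Sum>i<n. \<Sum>j<n. \<Prod>l\<in>u. \<kappa> (p i $ l) (p j $ l)) / (real n)\<^sup>2))"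
proof -
  let ?K = "\<lambda>x y. 1 + (\<Sum>u \<in> UNIV - {{}}. \<eta> u * (\<Prod>j\<in>u. \<kappa> (x $ j) (y $ j)))"
  have c: "continuous_on {0..1} (\<kappa> s)" if "s \<in> {0..1}" for s
    by (rule continuous_on_compose2[OF cont, of "{0..1}" "\<lambda>y. (s, y)", simplified])
       (use that in \<open>auto intro!: continuous_intros\<close>)
  have "continuous_on (cbox 0 1 \<times> cbox 0 1) (\<lambda>(x, y). ?K x y)"
    unfolding case_prod_beta
    by (intro continuous_intros continuous_on_compose2[OF cont, of _ "\<lambda>z. (fst z $ _, snd z $ _)", simplified])
       (auto intro!: continuous_intros simp: mem_box_cart)
  then have contK: "continuous_on (cbox 0 1 \<times> cbox 0 1) (\<lambda>(x, y). K x y)"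
    by (rule continuous_on_eq) (auto simp: K)
  have one: "integral (cbox 0 1) (K x) = 1" if x: "x \<in> cbox 0 1" for x
  proof -
    have x01: "x $ j \<in> {0..1}" for j using x by (auto simp: mem_box_cart)
    have cont_u: "continuous_on (cbox 0 1) (\<lambda>y. \<Prod>j\<in>u. \<kappa> (x $ j) (y $ j))" for u
      by (intro continuous_on_prod continuous_on_compose2[OF c[OF x01]])
         (auto intro!: continuous_intros simp: mem_box_cart)
    have zu: "integral (cbox 0 1) (\<lambda>y. \<Prod>j\<in>u. \<kappa> (x $ j) (y $ j)) = 0" if u: "u \<noteq> {}" for u
    proof -
      \<comment> \<open>Padding with the constant 1 outside \<open>u\<close> makes the integrand a
        product over all coordinates; any coordinate in \<open>u\<close> then contributes a factor
        0.\<close>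
      define f where "f j = (if j \<in> u then \<kappa> (x $ j) else (\<lambda>_. 1))" for j
      have "continuous_on {0..1} (f j)" for j using c[OF x01] by (simp add: f_def)
      from integral_unit_cube_prod[OF this]
      have "integral (cbox 0 1) (\<lambda>y. \<Prod>j\<in>UNIV. f j (y $ j)) = (\<Prod>j\<in>UNIV. integral {0..1} (f j))" .
      moreover have "(\<Prod>j\<in>UNIV. f j (y $ j)) = (\<Prod>j\<in>u. \<kappa> (x $ j) (y $ j))" for y
        by (rule prod.mono_neutral_cong_right) (auto simp: f_def)
      moreover have "(\<Prod>j\<in>UNIV. integral {0..1} (f j)) = 0"
        using u zero[OF x01] by (intro prod_zero) (auto simp: f_def)
      ultimately show ?thesis by simp
    qed
    have "((\<lambda>y. \<Prod>j\<in>u. \<kappa> (x $ j) (y $ j)) has_integral 0) (cbox 0 1)" if "u \<noteq> {}" for u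
      using integrable_integral[OF integrable_continuous[OF cont_u[of u]]] by (simp add: zu[OF that])
    then have "((\<lambda>y. \<Sum>u \<in> UNIV - {{}}. \<eta> u * (\<Prod>j\<in>u. \<kappa> (x $ j) (y $ j))) has_integral
        (\<Sum>u \<in> UNIV - {{}::'s set}. \<eta> u * 0)) (cbox 0 1)"
      by (intro has_integral_sum has_integral_mult_right) auto
    moreover have "((\<lambda>y. 1 :: real) has_integral 1) (cbox 0 (1 :: real ^ 's))"
      using has_integral_const[of "1::real" "0 :: real ^ 's" 1] by (simp add: content_unit_cube)
    ultimately have "(?K x has_integral 1 + (\<Sum>u \<in> UNIV - {{}::'s set}. \<eta> u * 0)) (cbox 0 1)"
      by (rule has_integral_add[rotated])
    then have "(?K x has_integral 1) (cbox 0 1)" by simp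
    then have "(K x has_integral 1) (cbox 0 1)"
      by (rule has_integral_eq[rotated]) (rule K[OF x, symmetric])
    then show ?thesis by (rule integral_unique)
  qed
  have eq: "(\<Sum>i<n. \<Sum>j<n. K (p i) (p j)) / (real n)\<^sup>2 - 1
     = (\<Sum>u \<in> UNIV - {{}}. \<eta> u * ((\<Sum>i<n. \<Sum>j<n. \<Prod>l\<in>u. \<kappa> (p i $ l) (p j $ l)) / (real n)\<^sup>2))"
  proof -
    have "(\<Sum>i<n. \<Sum>j<n. K (p i) (p j)) = (real n)\<^sup>2
        + (\<Sum>i<n. \<Sum>j<n. \<Sum>u \<in> UNIV - {{}}. \<eta> u * (\<Prod>l\<in>u. \<kappa> (p i $ l) (p j $ l)))"
      by (simp add: K p sum.distrib power2_eq_square)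
    also have "(\<Sum>i<n. \<Sum>j<n. \<Sum>u \<in> UNIV - {{}}. \<eta> u * (\<Prod>l\<in>u. \<kappa> (p i $ l) (p j $ l)))
        = (\<Sum>i<n. \<Sum>u \<in> UNIV - {{}}. \<Sum>j<n. \<eta> u * (\<Prod>l\<in>u. \<kappa> (p i $ l) (p j $ l)))"
      by (intro sum.cong refl sum.swap)
    also have "\<dots> = (\<Sum>u \<in> UNIV - {{}}. \<eta> u * (\<Sum>i<n. \<Sum>j<n. \<Prod>l\<in>u. \<kappa> (p i $ l) (p j $ l)))"
      by (subst sum.swap) (simp add: sum_distrib_left)
    finally show ?thesis using n by (simp add: add_divide_distrib sum_divide_distrib[of _ "UNIV - {{}}"])
  qed
  show "(worst_case_error (image_mset p (mset_set {0..<n})) H (rkhs_norm ip))\<^sup>2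
      = ennreal (\<Sum>u \<in> UNIV - {{}}. \<eta> u * ((\<Sum>i<n. \<Sum>j<n. \<Prod>l\<in>u. \<kappa> (p i $ l) (p j $ l)) / (real n)\<^sup>2))"
    by (rule worst_case_error_rkhs[where p = p, OF rkhs contK one n p, unfolded eq])
qed

section \<open>Cosine series of the second Bernoulli polynomial\<close>

text \<open>Since \<open>cos (pi * x)\<close> maps [0,1] homeomorphically onto [-1,1],
  Stone-Weierstrass approximates \<open>f\<close> uniformly by polynomials in it. \<open>f\<close>
  is orthogonal to all of these, so the integral of its square is below every positive
  \<open>e\<close>.\<close>

lemma cosine_coefficients_zero_imp_zero:
  fixes f :: "real \<Rightarrow> real"
  assumes f: "continuous_on {0..1} f"
    and zero: "\<And>m::nat. integral {0..1} (\<lambda>x. f x * cos (pi * real m * x)) = 0"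
    and x: "x \<in> {0..1}"
  shows "f x = 0"
proof -
  have int: "(\<lambda>x. f x * g x) integrable_on {0..1}" if "continuous_on UNIV g" for g
    by (intro integrable_continuous_real continuous_on_mult f continuous_on_subset[OF that]) simp
  \<comment> \<open>The product-to-sum formula lowers the power and shifts the frequency by one
    either way; \<open>m\<close> is an integer because it can become negative.\<close>
  have pow: "integral {0..1} (\<lambda>x. f x * (cos (pi * x) ^ i * cos (pi * of_int m * x))) = 0" for i m
  proof (induction i arbitrary: m)
    case 0
    have "cos (pi * of_int m * x) = cos (pi * real (nat \<bar>m\<bar>) * x)" for x
      by (cases "m \<ge> 0") simp_all
    then show ?case using zero[of "nat \<bar>m\<bar>"] by simp
  next
    case (Suc i)
    have eq: "f x * (cos (pi * x) ^ Suc i * cos (pi * of_int m * x))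
        = f x * (cos (pi * x) ^ i * cos (pi * of_int (m + 1) * x)) * (1 / 2)
        + f x * (cos (pi * x) ^ i * cos (pi * of_int (m - 1) * x)) * (1 / 2)" for x
      by (simp add: algebra_simps cos_add cos_diff)
    have intg: "(\<lambda>x. f x * (cos (pi * x) ^ i * cos (pi * of_int m * x)) * (1 / 2)) integrable_on {0..1}" for m
      by (intro integrable_on_mult_left int continuous_intros)
    show ?case unfolding eq integral_add[OF intg intg] integral_mult_left Suc by simp
  qed
  have poly: "integral {0..1} (\<lambda>x. f x * (\<Sum>i\<le>n. a i * cos (pi * x) ^ i)) = 0" for a :: "nat \<Rightarrow> real" and n
  proof -
    have "integral {0..1} (\<lambda>x. \<Sum>i\<le>n. a i * (f x * cos (pi * x) ^ i)) = (\<Sum>i\<le>n. a i * 0)"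
      using pow[of _ 0]
      by (subst integral_sum) (auto intro!: integrable_on_mult_right int continuous_intros)
    then show ?thesis by (simp add: sum_distrib_left mult_ac)
  qed
  have "bounded (f ` {0..1})" by (intro compact_imp_bounded compact_continuous_image f compact_Icc)
  then obtain B where "\<forall>x\<in>{0..1}. \<bar>f x\<bar> \<le> B" unfolding bounded_iff by auto
  then have B: "\<bar>f x\<bar> \<le> B" if "x \<in> {0..1}" for x using that by blast
  have B0: "0 \<le> B" using B[OF x] by simp
  have cont2: "continuous_on {0..1} (\<lambda>x. f x * f x)" by (intro continuous_intros f)
  have "integral {0..1} (\<lambda>x. f x * f x) \<le> e" if e: "e > 0" for e
  proof -
    define d where "d = e / (B + 1)"
    have d: "d > 0" using e B0 by (simp add: d_def)
    have "B * d \<le> (B + 1) * d" using d by simp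
    also have "\<dots> = e" using B0 by (simp add: d_def)
    finally have Bd: "B * d \<le> e" .
    have "continuous_on {-1..1} (\<lambda>c. f (arccos c / pi))"
      by (rule continuous_on_compose2[OF f]) (auto intro!: continuous_intros divide_nonneg_pos arccos_lbound arccos_ubound)
    then obtain g where g: "real_polynomial_function g" "\<And>c. c \<in> {-1..1} \<Longrightarrow> \<bar>f (arccos c / pi) - g c\<bar> < d"
      using Stone_Weierstrass_real_polynomial_function[OF compact_Icc _ d] by blast
    then obtain a n where gs: "g = (\<lambda>x. \<Sum>i\<le>n. a i * x ^ i)"
      using real_polynomial_function_iff_sum by blast
    have close: "\<bar>f x - g (cos (pi * x))\<bar> \<le> d" if "x \<in> {0..1}" for x
      using g(2)[of "cos (pi * x)"] that by (simp add: arccos_cos)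
    have contg: "continuous_on UNIV (\<lambda>x. g (cos (pi * x)))" unfolding gs by (intro continuous_intros)
    have "integral {0..1} (\<lambda>x. f x * f x)
        = integral {0..1} (\<lambda>x. f x * (f x - g (cos (pi * x))) + f x * g (cos (pi * x)))"
      by (simp add: algebra_simps)
    also have "\<dots> = integral {0..1} (\<lambda>x. f x * (f x - g (cos (pi * x)))) + 0"
      using poly[of a n] int[OF contg]
      by (subst integral_add)
         (auto intro!: integrable_continuous_real continuous_intros f continuous_on_subset[OF contg] simp: gs)
    also have "\<dots> \<le> e"
    proof -
      have "norm (integral {0..1} (\<lambda>x. f x * (f x - g (cos (pi * x))))) \<le> integral {0..1} (\<lambda>x::real. B * d)"
        by (rule integral_norm_bound_integral)
           (auto intro!: integrable_continuous_real continuous_intros f continuous_on_subset[OF contg]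
             mult_mono B close simp: abs_mult B0)
      then show ?thesis using Bd by simp
    qed
    finally show ?thesis .
  qed
  then have "integral {0..1} (\<lambda>x. f x * f x) \<le> 0" by (rule field_le_epsilon[where y = 0, simplified])
  moreover have "integral {0..1} (\<lambda>x. f x * f x) \<ge> 0"
    by (rule integral_nonneg) (auto intro!: integrable_continuous_real cont2)
  ultimately have "integral {0..1} (\<lambda>x. f x * f x) = 0" by simp
  then have "\<forall>x\<in>{0..1}. f x * f x = 0"
    using integral_eq_0_iff[OF cont2] by simp
  then show ?thesis using x by simp
qed

section \<open>Cosine coefficients of the half-argument \<open>B_2\<close>\<close>

lemma integral_cos_int: "integral {0..1} (\<lambda>x. cos (pi * of_int m * x)) = (if m = 0 then 1 else 0)"
proof (cases "m = 0")
  case False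
  have "((\<lambda>x. cos (pi * of_int m * x)) has_integral
      sin (pi * of_int m * 1) / (pi * of_int m) - sin (pi * of_int m * 0) / (pi * of_int m)) {0..1}"
    by (rule fundamental_theorem_of_calculus)
       (use False in \<open>auto intro!: derivative_eq_intros simp: has_real_derivative_iff_has_vector_derivative[symmetric]\<close>)
  moreover have "sin (pi * of_int m) = 0" using sin_times_pi_eq_0[of "of_int m :: real"] by (simp add: mult.commute)
  ultimately show ?thesis using False by (simp add: integral_unique)
qed simp

lemma integral_cos_cos:
  "integral {0..1} (\<lambda>x. cos (pi * real (Suc k) * x) * cos (pi * real m * x)) = (if m = Suc k then 1 / 2 else 0)"
proof -
  have "cos (pi * real (Suc k) * x) * cos (pi * real m * x)
      = cos (pi * of_int (int (Suc k) + int m) * x) * (1 / 2) + cos (pi * of_int (int (Suc k) - int m) * x) * (1 / 2)" for x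
    by (simp only: of_int_add of_int_diff of_int_of_nat_eq ring_distribs left_diff_distrib right_diff_distrib cos_add cos_diff)
  then have "integral {0..1} (\<lambda>x. cos (pi * real (Suc k) * x) * cos (pi * real m * x))
      = integral {0..1} (\<lambda>x. cos (pi * of_int (int (Suc k) + int m) * x)) * (1 / 2)
      + integral {0..1} (\<lambda>x. cos (pi * of_int (int (Suc k) - int m) * x)) * (1 / 2)"
    by (simp only: integral_mult_left[symmetric])
       (intro integral_add integrable_continuous_real continuous_intros)
  then show ?thesis unfolding integral_cos_int by auto
qed

text \<open>This is B_2(t / 2): halving the argument makes all frequencies pi k occur in its series.\<close>

definition bern2 :: "real \<Rightarrow> real" where
  "bern2 t = t\<^sup>2 / 4 - t / 2 + 1 / 6"

lemma integral_bern2_cos: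
  "integral {0..1} (\<lambda>t. bern2 t * cos (pi * real m * t)) = (if m = 0 then 0 else 1 / (2 * (pi * real m)\<^sup>2))"
proof (cases "m = 0")
  case True
  have "(bern2 has_integral (1 ^ 3 / 12 - 1\<^sup>2 / 4 + 1 / 6) - (0 ^ 3 / 12 - 0\<^sup>2 / 4 + 0 / 6)) {0..1}"
    unfolding bern2_def
    by (rule fundamental_theorem_of_calculus)
       (auto intro!: derivative_eq_intros simp: has_real_derivative_iff_has_vector_derivative[symmetric])
  then show ?thesis using True by (simp add: integral_unique)
next
  case False
  define a where "a = pi * real m"
  have a: "a \<noteq> 0" "sin a = 0" using False by (simp_all add: a_def mult.commute)
  \<comment> \<open>Obtained by repeated integration by parts. As \<open>sin a = 0\<close>, the
    middle term alone survives at the end points, and it does so only at 0, where it equals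
    \<open>- 1 / (2 * a^2)\<close>.\<close>
  let ?F = "\<lambda>t. bern2 t * sin (a * t) / a + (t / 2 - 1 / 2) * cos (a * t) / a\<^sup>2 - sin (a * t) / (2 * a ^ 3)"
  have "((\<lambda>t. bern2 t * cos (a * t)) has_integral ?F 1 - ?F 0) {0..1}"
    unfolding bern2_def
    by (rule fundamental_theorem_of_calculus)
       (use a in \<open>auto intro!: derivative_eq_intros
         simp: has_real_derivative_iff_has_vector_derivative[symmetric] field_simps power2_eq_square power3_eq_cube\<close>)
  then show ?thesis using False a by (simp add: integral_unique a_def)
qed

lemma summable_inverse_Suc_squares: "summable (\<lambda>k. 1 / (pi * real (Suc k))\<^sup>2)"
  using summable_mult[OF sums_summable[OF inverse_squares_sums], of "1 / pi\<^sup>2"]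
  by (simp add: power_mult_distrib)

text \<open>The series converges uniformly, so its sum \<open>S\<close> is continuous and can be
  integrated termwise against cosines. \<open>bern2\<close> and \<open>S\<close> then have equal
  cosine coefficients, and uniqueness identifies them.\<close>

lemma bern2_cosine_series_unit:
  assumes t: "t \<in> {0..1}"
  shows "(\<lambda>k. cos (pi * real (Suc k) * t) / (pi * real (Suc k))\<^sup>2) sums bern2 t"
proof -
  define c where "c k t = cos (pi * real (Suc k) * t) / (pi * real (Suc k))\<^sup>2" for k t
  define S where "S t = (\<Sum>k. c k t)" for t
  have cb: "norm (c k t) \<le> 1 / (pi * real (Suc k))\<^sup>2" for k t
    by (simp add: c_def divide_right_mono)
  have sm: "summable (\<lambda>k. c k t)" for t
    by (rule summable_comparison_test'[OF summable_inverse_Suc_squares cb])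
  have uni: "uniform_limit {0..1} (\<lambda>n t. \<Sum>k<n. c k t) S sequentially"
    unfolding S_def by (rule Weierstrass_m_test[OF cb summable_inverse_Suc_squares])
  have contS: "continuous_on {0..1} S"
    by (rule uniform_limit_theorem[OF _ uni])
       (auto intro!: always_eventually continuous_intros simp: c_def)
  define f where "f t = bern2 t - S t" for t
  have contf: "continuous_on {0..1} f" unfolding f_def bern2_def by (intro continuous_intros contS) auto
  have "integral {0..1} (\<lambda>t. f t * cos (pi * real m * t)) = 0" for m
  proof -
    have fin: "(\<Sum>k<n. c k t) * cos (pi * real m * t)
        = (\<Sum>k<n. 1 / (pi * real (Suc k))\<^sup>2 * (cos (pi * real (Suc k) * t) * cos (pi * real m * t)))" for n t
      by (simp add: c_def sum_distrib_right)
    have intn: "integral {0..1} (\<lambda>t. (\<Sum>k<n. c k t) * cos (pi * real m * t))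
        = (\<Sum>k<n. 1 / (pi * real (Suc k))\<^sup>2 * (if m = Suc k then 1 / 2 else 0))" for n
      unfolding fin
      by (subst integral_sum)
         (auto intro!: integrable_continuous_real continuous_intros simp only: integral_mult_right integral_cos_cos)
    have bound: "norm ((\<Sum>k<n. c k t) * cos (pi * real m * t)) \<le> (\<Sum>k. 1 / (pi * real (Suc k))\<^sup>2)" for n t
    proof -
      have "norm ((\<Sum>k<n. c k t) * cos (pi * real m * t)) \<le> norm (\<Sum>k<n. c k t) * 1"
        unfolding norm_mult by (intro mult_left_mono) auto
      also have "\<dots> \<le> (\<Sum>k<n. 1 / (pi * real (Suc k))\<^sup>2)" 
        using sum_norm_le[of "{..<n}" "\<lambda>k. c k t", OF cb] by simp
      also have "\<dots> \<le> (\<Sum>k. 1 / (pi * real (Suc k))\<^sup>2)"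
        by (rule sum_le_suminf[OF summable_inverse_Suc_squares]) auto
      finally show ?thesis .
    qed
    have "(\<lambda>n. integral {0..1} (\<lambda>t. (\<Sum>k<n. c k t) * cos (pi * real m * t)))
        \<longlonglongrightarrow> integral {0..1} (\<lambda>t. S t * cos (pi * real m * t))"
    proof (rule dominated_convergence(2)[OF _ _ bound])
      show "(\<lambda>n. (\<Sum>k<n. c k t) * cos (pi * real m * t)) \<longlonglongrightarrow> S t * cos (pi * real m * t)" for t
        unfolding S_def by (intro tendsto_intros summable_LIMSEQ sm)
    qed (auto intro!: integrable_continuous_real continuous_intros simp: c_def)
    then have lim: "(\<lambda>n. \<Sum>k<n. 1 / (pi * real (Suc k))\<^sup>2 * (if m = Suc k then 1 / 2 else 0))
        \<longlonglongrightarrow> integral {0..1} (\<lambda>t. S t * cos (pi * real m * t))"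
      by (simp only: intn)
    \<comment> \<open>Only the index \<open>k = m - 1\<close> contributes, and it is in range once
      \<open>n \<ge> m\<close>; for \<open>m = 0\<close> there is none.\<close>
    have "(\<Sum>k<n. 1 / (pi * real (Suc k))\<^sup>2 * (if m = Suc k then 1 / 2 else 0))
        = (if m = 0 then 0 else 1 / (2 * (pi * real m)\<^sup>2))" if n: "n \<ge> m" for n
    proof (cases m)
      case (Suc l)
      have "(\<Sum>k<n. 1 / (pi * real (Suc k))\<^sup>2 * (if m = Suc k then 1 / 2 else 0))
         = (\<Sum>k<n. if k = l then 1 / (2 * (pi * real m)\<^sup>2) else 0)"
        by (rule sum.cong) (auto simp: Suc)
      then show ?thesis using Suc n by simp
    qed simp
    then have ev: "\<forall>\<^sub>F n in sequentially. (\<Sum>k<n. 1 / (pi * real (Suc k))\<^sup>2 * (if m = Suc k then 1 / 2 else 0))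
        = (if m = 0 then 0 else 1 / (2 * (pi * real m)\<^sup>2))"
      by (intro eventually_mono[OF eventually_ge_at_top[of m]])
    have "integral {0..1} (\<lambda>t. S t * cos (pi * real m * t)) = (if m = 0 then 0 else 1 / (2 * (pi * real m)\<^sup>2))"
      by (rule LIMSEQ_unique[OF lim tendsto_eventually[OF ev]])
    moreover have "integral {0..1} (\<lambda>t. f t * cos (pi * real m * t))
        = integral {0..1} (\<lambda>t. bern2 t * cos (pi * real m * t)) - integral {0..1} (\<lambda>t. S t * cos (pi * real m * t))"
      unfolding f_def left_diff_distrib
      by (rule integral_diff) (auto intro!: integrable_continuous_real continuous_intros contS simp: bern2_def)
    ultimately show ?thesis by (simp add: integral_bern2_cos)
  qed
  from cosine_coefficients_zero_imp_zero[OF contf this t] have "bern2 t = S t" by (simp add: f_def)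
  then show ?thesis using summable_sums[OF sm[of t]] by (simp add: S_def c_def)
qed

text \<open>Both sides are symmetric about 1. The range up to 2 is what the arguments
  \<open>x + 1\<close>, \<open>x + t\<close> and \<open>2 * \<bar>t\<bar>\<close> require
  later.\<close>

lemma bern2_cosine_series:
  assumes t: "t \<in> {0..2}"
  shows "(\<lambda>k. cos (pi * real (Suc k) * t) / (pi * real (Suc k))\<^sup>2) sums bern2 t"
proof (cases "t \<le> 1")
  case False
  have "cos (pi * real (Suc k) * (2 - t)) = cos (pi * real (Suc k) * t)" for k
  proof -
    have "pi * real (Suc k) * (2 - t) = 2 * real (Suc k) * pi - pi * real (Suc k) * t"
      by (simp add: algebra_simps)
    then show ?thesis by (simp only: cos_diff cos_2npi sin_2npi)
  qed
  moreover have "bern2 (2 - t) = bern2 t" by (simp add: bern2_def power2_eq_square field_simps)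
  ultimately show ?thesis using bern2_cosine_series_unit[of "2 - t"] t False by simp
qed (use bern2_cosine_series_unit[of t] t in auto)

section \<open>The one-dimensional Sobolev kernel\<close>

lemma bernoulli_numbers:
  "bernoulli_number 0 = 1" "bernoulli_number 1 = - 1 / 2" "bernoulli_number 2 = 1 / 6"
  "bernoulli_number 3 = 0" "bernoulli_number 4 = - 1 / 30"
proof -
  show 0: "bernoulli_number 0 = 1" by (subst bernoulli_number.simps) simp
  show 1: "bernoulli_number 1 = - 1 / 2" by (subst bernoulli_number.simps) (simp add: 0)
  have b: "bernoulli_number (Suc 0) = - 1 / 2" using 1 by simp
  show 2: "bernoulli_number 2 = 1 / 6"
    by (subst bernoulli_number.simps) (simp add: 0 b numeral_2_eq_2)
  have c: "(4::nat) choose 2 = 6" "(5::nat) choose 2 = 10" "(5::nat) choose 3 = 10"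
    by (simp_all add: binomial_code fold_atLeastAtMost_nat.simps)
  show 3: "bernoulli_number 3 = 0"
    by (subst bernoulli_number.simps) (simp add: 0 b 2 c lessThan_nat_numeral)
  show "bernoulli_number 4 = - 1 / 30"
    by (subst bernoulli_number.simps) (simp add: 0 b 2 3 c lessThan_nat_numeral)
qed

lemma poly_bernoulli:
  "poly (bernoulli_poly 1) x = x - 1 / 2"
  "poly (bernoulli_poly 2) x = x\<^sup>2 - x + 1 / 6"
  "poly (bernoulli_poly 4) x = x ^ 4 - 2 * x ^ 3 + x\<^sup>2 - 1 / 30"
proof -
  have b: "bernoulli_number (Suc 0) = - 1 / 2" using bernoulli_numbers(2) by simp
  have b2: "bernoulli_number (Suc (Suc 0)) = 1 / 6" using bernoulli_numbers(3) by (simp add: numeral_2_eq_2)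
  have c: "(4::nat) choose 2 = 6" "(4::nat) choose 3 = 4"
    by (simp_all add: binomial_code fold_atLeastAtMost_nat.simps)
  show "poly (bernoulli_poly 1) x = x - 1 / 2"
    by (simp add: bernoulli_poly_def poly_monom bernoulli_numbers b)
  show "poly (bernoulli_poly 2) x = x\<^sup>2 - x + 1 / 6"
    by (simp add: bernoulli_poly_def poly_monom bernoulli_numbers b b2 numeral_2_eq_2)
  show "poly (bernoulli_poly 4) x = x ^ 4 - 2 * x ^ 3 + x\<^sup>2 - 1 / 30"
    by (simp add: bernoulli_poly_def poly_monom bernoulli_numbers b atMost_nat_numeral c)
qed

definition sobolev_factor :: "real \<Rightarrow> real \<Rightarrow> real" where
  "sobolev_factor x y = poly (bernoulli_poly 1) x * poly (bernoulli_poly 1) y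
     + poly (bernoulli_poly 2) x * poly (bernoulli_poly 2) y / 4 - poly (bernoulli_poly 4) \<bar>x - y\<bar> / 24"

lemma sobolev_factor_eq: "sobolev_factor x y = (x - 1 / 2) * (y - 1 / 2) + (x\<^sup>2 - x + 1 / 6) * (y\<^sup>2 - y + 1 / 6) / 4
    - (\<bar>x - y\<bar> ^ 4 - 2 * \<bar>x - y\<bar> ^ 3 + \<bar>x - y\<bar>\<^sup>2 - 1 / 30) / 24"
  by (simp only: sobolev_factor_def poly_bernoulli)

section \<open>A square root of the kernel and its cosine series\<close>

text \<open>
  Here \<open>green x t\<close> is (B_2(|x - t|) - B_2(x)) / 2, a square root of the kernel without its rank-one part
  B_1(x) B_1(y); its cosine series follow from the one for B_2.
\<close>

definition green :: "real \<Rightarrow> real \<Rightarrow> real" where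
  "green x t = (t\<^sup>2 - 2 * x * t - \<bar>x - t\<bar> + x) / 2"

text \<open>An antiderivative in \<open>t\<close> of the product of
  \<open>(t^2 + p t + c) / 2\<close> and \<open>(t^2 + q t + d) / 2\<close>, the shape of
  \<open>green x t * green y t\<close> between break points.\<close>

definition quartic_antideriv :: "real \<Rightarrow> real \<Rightarrow> real \<Rightarrow> real \<Rightarrow> real \<Rightarrow> real" where
  "quartic_antideriv p c q d t = (t ^ 5 / 5 + (p + q) * t ^ 4 / 4 + (p * q + c + d) * t ^ 3 / 3 + (p * d + q * c) * t ^ 2 / 2 + c * d * t) / 4"

lemma has_integral_quadratic_mult:
  assumes "a \<le> b"
  shows "((\<lambda>t. (t\<^sup>2 + p * t + c) / 2 * ((t\<^sup>2 + q * t + d) / 2)) has_integral (quartic_antideriv p c q d b - quartic_antideriv p c q d a)) {a..b}"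
proof (rule fundamental_theorem_of_calculus[OF assms])
  fix t
  have "(quartic_antideriv p c q d has_real_derivative (t ^ 4 + (p + q) * t ^ 3 + (p * q + c + d) * t ^ 2 + (p * d + q * c) * t + c * d) / 4)
      (at t within {a..b})"
    unfolding quartic_antideriv_def[abs_def] by (rule derivative_eq_intros refl | simp)+
  moreover have "(t ^ 4 + (p + q) * t ^ 3 + (p * q + c + d) * t ^ 2 + (p * d + q * c) * t + c * d) / 4
      = (t\<^sup>2 + p * t + c) / 2 * ((t\<^sup>2 + q * t + d) / 2)"
    by (simp add: field_simps) algebra
  ultimately show "(quartic_antideriv p c q d has_vector_derivative (t\<^sup>2 + p * t + c) / 2 * ((t\<^sup>2 + q * t + d) / 2)) (at t within {a..b})"
    by (simp only: has_real_derivative_iff_has_vector_derivative)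
qed

text \<open>As a function of \<open>t\<close>, \<open>green x t\<close> is half of a monic quadratic
  on either side of \<open>t = x\<close>. For \<open>x \<le> y\<close> this leaves three intervals
  with polynomial integrands; the other order follows by symmetry.\<close>

lemma integral_green_green:
  assumes "x \<in> {0..1}" "y \<in> {0..1}"
  shows "integral {0..1} (\<lambda>t. green x t * green y t) = sobolev_factor x y - (x - 1 / 2) * (y - 1 / 2)"
proof -
  have *: "integral {0..1} (\<lambda>t. green x t * green y t) = sobolev_factor x y - (x - 1 / 2) * (y - 1 / 2)"
    if xy: "0 \<le> x" "x \<le> y" "y \<le> 1" for x y
  proof -
    \<comment> \<open>Twice \<open>green x t\<close> is \<open>t^2 + (1 - 2 x) t\<close> for
      \<open>t \<le> x\<close> and \<open>t^2 - (1 + 2 x) t + 2 x\<close> for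
      \<open>t \<ge> x\<close>, which supplies the parameters on all three intervals.\<close>
    have "((\<lambda>t. green x t * green y t) has_integral
        (quartic_antideriv (1 - 2 * x) 0 (1 - 2 * y) 0 x - quartic_antideriv (1 - 2 * x) 0 (1 - 2 * y) 0 0)) {0..x}"
      by (rule has_integral_eq[OF _ has_integral_quadratic_mult]) (use xy in \<open>auto simp: green_def algebra_simps\<close>)
    moreover have "((\<lambda>t. green x t * green y t) has_integral
        (quartic_antideriv (- 1 - 2 * x) (2 * x) (1 - 2 * y) 0 y - quartic_antideriv (- 1 - 2 * x) (2 * x) (1 - 2 * y) 0 x)) {x..y}"
      by (rule has_integral_eq[OF _ has_integral_quadratic_mult]) (use xy in \<open>auto simp: green_def algebra_simps\<close>)
    moreover have "((\<lambda>t. green x t * green y t) has_integral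
        (quartic_antideriv (- 1 - 2 * x) (2 * x) (- 1 - 2 * y) (2 * y) 1 - quartic_antideriv (- 1 - 2 * x) (2 * x) (- 1 - 2 * y) (2 * y) y)) {y..1}"
      by (rule has_integral_eq[OF _ has_integral_quadratic_mult]) (use xy in \<open>auto simp: green_def algebra_simps\<close>)
    ultimately have "((\<lambda>t. green x t * green y t) has_integral
        (quartic_antideriv (1 - 2 * x) 0 (1 - 2 * y) 0 x - quartic_antideriv (1 - 2 * x) 0 (1 - 2 * y) 0 0
         + (quartic_antideriv (- 1 - 2 * x) (2 * x) (1 - 2 * y) 0 y - quartic_antideriv (- 1 - 2 * x) (2 * x) (1 - 2 * y) 0 x)
         + (quartic_antideriv (- 1 - 2 * x) (2 * x) (- 1 - 2 * y) (2 * y) 1 - quartic_antideriv (- 1 - 2 * x) (2 * x) (- 1 - 2 * y) (2 * y) y))) {0..1}"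
      using xy by (intro has_integral_combine[of 0 y 1] has_integral_combine[of 0 x y]) auto
    moreover have "quartic_antideriv (1 - 2 * x) 0 (1 - 2 * y) 0 x - quartic_antideriv (1 - 2 * x) 0 (1 - 2 * y) 0 0
         + (quartic_antideriv (- 1 - 2 * x) (2 * x) (1 - 2 * y) 0 y - quartic_antideriv (- 1 - 2 * x) (2 * x) (1 - 2 * y) 0 x)
         + (quartic_antideriv (- 1 - 2 * x) (2 * x) (- 1 - 2 * y) (2 * y) 1 - quartic_antideriv (- 1 - 2 * x) (2 * x) (- 1 - 2 * y) (2 * y) y)
         = sobolev_factor x y - (x - 1 / 2) * (y - 1 / 2)"
    proof -
      have "\<bar>x - y\<bar> = y - x" using xy by simp
      then show ?thesis unfolding sobolev_factor_eq quartic_antideriv_def by (simp add: eval_nat_numeral field_simps)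
    qed
    ultimately show ?thesis by (simp add: integral_unique)
  qed
  show ?thesis
  proof (cases "x \<le> y")
    case False
    have "sobolev_factor y x = sobolev_factor x y" by (simp add: sobolev_factor_eq abs_minus_commute mult.commute)
    then show ?thesis using *[of y x] False assms by (simp add: mult.commute)
  qed (use * assms in auto)
qed

text \<open>
  Up to the factor 2 / (pi k)^2, this is the k-th cosine coefficient of \<open>green x t\<close> as a function
  of \<open>x\<close>.
\<close>

definition green_coeff :: "nat \<Rightarrow> real \<Rightarrow> real" where
  "green_coeff k t = cos (pi * real k * t) - (1 + (-1) ^ k) / 2 - (1 / 2 - t) * (1 - (-1) ^ k)"

text \<open>A shift by 1 multiplies the term of frequency \<open>k\<close> by \<open>(-1)^k\<close>.
  So \<open>bern2 x - bern2 (x + 1)\<close> keeps only odd frequencies, and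
  \<open>bern2 x + bern2 (x + 1)\<close> only even ones; these are \<open>B_1\<close> and
  \<open>B_2\<close> up to a factor.\<close>

lemma cos_shift: "cos (pi * real k * (x + 1)) = (-1) ^ k * cos (pi * real k * x)"
proof -
  have "pi * real k * (x + 1) = pi * real k * x + real k * pi" by (simp add: algebra_simps)
  then show ?thesis by (simp only: cos_add cos_npi sin_npi) simp
qed

lemma bernoulli1_series:
  assumes "x \<in> {0..1}"
  shows "(\<lambda>k. - 2 * (1 - (-1) ^ Suc k) * cos (pi * real (Suc k) * x) / (pi * real (Suc k))\<^sup>2) sums (x - 1 / 2)"
proof -
  have "(\<lambda>k. - 2 * (cos (pi * real (Suc k) * x) / (pi * real (Suc k))\<^sup>2
      - cos (pi * real (Suc k) * (x + 1)) / (pi * real (Suc k))\<^sup>2)) sums (- 2 * (bern2 x - bern2 (x + 1)))"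
    using assms by (intro sums_mult sums_diff bern2_cosine_series) auto
  moreover have "- 2 * (bern2 x - bern2 (x + 1)) = x - 1 / 2"
    by (simp add: bern2_def power2_eq_square field_simps)
  moreover have "- 2 * (C / D - e * C / D) = - 2 * (1 - e) * C / D" for C D e :: real
    by (simp add: divide_inverse algebra_simps)
  ultimately show ?thesis by (simp only: cos_shift)
qed

lemma bernoulli2_series:
  assumes "x \<in> {0..1}"
  shows "(\<lambda>k. 2 * (1 + (-1) ^ Suc k) * cos (pi * real (Suc k) * x) / (pi * real (Suc k))\<^sup>2) sums (x\<^sup>2 - x + 1 / 6)"
proof -
  have "(\<lambda>k. 2 * (cos (pi * real (Suc k) * x) / (pi * real (Suc k))\<^sup>2
      + cos (pi * real (Suc k) * (x + 1)) / (pi * real (Suc k))\<^sup>2)) sums (2 * (bern2 x + bern2 (x + 1)))"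
    using assms by (intro sums_mult sums_add bern2_cosine_series) auto
  moreover have "2 * (bern2 x + bern2 (x + 1)) = x\<^sup>2 - x + 1 / 6"
    by (simp add: bern2_def power2_eq_square field_simps)
  moreover have "2 * (C / D + e * C / D) = 2 * (1 + e) * C / D" for C D e :: real
    by (simp add: divide_inverse algebra_simps)
  ultimately show ?thesis by (simp only: cos_shift)
qed

text \<open>Rests on \<open>green x t = bern2 \<bar>x - t\<bar> + bern2 (x + t) - B_2(x) / 2 -
  B_1(t) B_1(x)\<close>. Adding the reflected argument \<open>x + t\<close> separates the variables:
  each pair of cosines becomes a product. The last two terms produce the parity-dependent
  corrections in \<open>green_coeff\<close>.\<close>

lemma green_series:
  assumes x: "x \<in> {0..1}" and t: "t \<in> {0..1}"
  shows "(\<lambda>k. 2 * green_coeff (Suc k) t * cos (pi * real (Suc k) * x) / (pi * real (Suc k))\<^sup>2) sums green x t"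
proof -
  define c where "c k u = cos (pi * real (Suc k) * u) / (pi * real (Suc k))\<^sup>2" for k u
  have cc: "c k \<bar>x - t\<bar> + c k (x + t) = 2 * cos (pi * real (Suc k) * t) * cos (pi * real (Suc k) * x) / (pi * real (Suc k))\<^sup>2" for k
  proof -
    have "cos (A * \<bar>x - t\<bar>) = cos (A * (x - t))" if "A > 0" for A
      using that cos_abs_real[of "A * (x - t)"] by (simp add: abs_mult)
    then have "cos (A * \<bar>x - t\<bar>) + cos (A * (x + t)) = 2 * cos (A * t) * cos (A * x)" if "A > 0" for A
      using that by (simp add: right_diff_distrib distrib_left cos_add cos_diff)
    then show ?thesis
      unfolding c_def add_divide_distrib[symmetric] by simp
  qed
  have "(\<lambda>k. c k \<bar>x - t\<bar> + c k (x + t)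
      - (1 / 2) * (2 * (1 + (-1) ^ Suc k) * cos (pi * real (Suc k) * x) / (pi * real (Suc k))\<^sup>2)
      - (t - 1 / 2) * (- 2 * (1 - (-1) ^ Suc k) * cos (pi * real (Suc k) * x) / (pi * real (Suc k))\<^sup>2))
    sums (bern2 \<bar>x - t\<bar> + bern2 (x + t) - (1 / 2) * (x\<^sup>2 - x + 1 / 6) - (t - 1 / 2) * (x - 1 / 2))"
    unfolding c_def using x t
    by (intro sums_diff sums_add sums_mult bern2_cosine_series bernoulli1_series bernoulli2_series) auto
  moreover have "bern2 \<bar>x - t\<bar> + bern2 (x + t) - (1 / 2) * (x\<^sup>2 - x + 1 / 6) - (t - 1 / 2) * (x - 1 / 2) = green x t"
    by (simp add: bern2_def green_def power2_eq_square field_simps)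
  moreover have "2 * u * C / D - (1 / 2) * (2 * (1 + e) * C / D) - (t - 1 / 2) * (- 2 * (1 - e) * C / D)
      = 2 * (u - (1 + e) / 2 - (1 / 2 - t) * (1 - e)) * C / D" for C D e u :: real
  proof -
    have "2 * u * q - (1 / 2) * (2 * (1 + e) * q) - (t - 1 / 2) * (- 2 * (1 - e) * q)
      = 2 * (u - (1 + e) / 2 - (1 / 2 - t) * (1 - e)) * q" for q :: real
      by (simp add: field_simps)
    from this[of "C / D"] show ?thesis by (simp only: times_divide_eq_right)
  qed
  ultimately show ?thesis by (simp only: cc green_coeff_def)
qed

section \<open>The double cosine series of the Sobolev factor\<close>

lemma continuous_on_green_coeff: "continuous_on S (green_coeff k)"
  unfolding green_coeff_def by (intro continuous_intros)

text \<open>The value of the bound is immaterial: it provides the majorant for dominated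
  convergence.\<close>

lemma abs_green_coeff_le: "t \<in> {0..1} \<Longrightarrow> \<bar>green_coeff k t\<bar> \<le> 2"
proof -
  assume t: "t \<in> {0..1}"
  define c where "c = cos (pi * real k * t)"
  have o: "green_coeff k t = c - (1 + (-1) ^ k) / 2 - (1 / 2 - t) * (1 - (-1) ^ k)" by (simp only: green_coeff_def c_def)
  have "- 1 \<le> c" "c \<le> 1" by (simp_all add: c_def)
  then show ?thesis using t by (cases "even k") (auto simp: o abs_le_iff algebra_simps)
qed

text \<open>A Gram matrix: the inner product in R x L2[0,1] of the pairs
  \<open>(1 - (-1)^k, green_coeff k)\<close>. The first component comes from the series of
  \<open>B_1\<close>, and the common factor \<open>4 / ((pi k)^2 (pi l)^2)\<close> has been split
  off.\<close>

definition sobolev_coeff :: "nat \<Rightarrow> nat \<Rightarrow> real" where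
  "sobolev_coeff k l = (1 - (-1) ^ k) * (1 - (-1) ^ l) + integral {0..1} (\<lambda>t. green_coeff k t * green_coeff l t)"

text \<open>
  By AM-GM the bound reduces to \<open>k = l\<close>; there it is 4 + 5 / 6 for odd \<open>k\<close> and 3 / 2 for even \<open>k\<close>.
\<close>

lemma abs_sobolev_coeff_le: "\<bar>sobolev_coeff k l\<bar> \<le> 29 / 6" if kl: "k > 0" "l > 0"
proof -
  have int: "(\<lambda>t. green_coeff k t * green_coeff l t) integrable_on {0..1}" for k l
    by (intro integrable_continuous_real continuous_intros continuous_on_green_coeff)
  have diag: "(1 - (-1) ^ k)\<^sup>2 + integral {0..1} (\<lambda>t. green_coeff k t * green_coeff k t) \<le> 29 / 6" if k: "k > 0" for k
  proof -
    define a where "a = pi * real k"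
    have a: "a \<noteq> 0" "sin a = 0" using k by (simp_all add: a_def mult.commute)
    have sc: "sin (a * t) * sin (a * t) = 1 - cos (a * t) * cos (a * t)" for t
      using sin_cos_squared_add3[of "a * t"] by linarith
    show ?thesis
    proof (cases "even k")
      case True
      \<comment> \<open>For even \<open>k\<close>, \<open>green_coeff k t\<close> is
        \<open>cos (a * t) - 1\<close>.\<close>
      let ?F = "\<lambda>t. t / 2 + sin (a * t) * cos (a * t) / (2 * a) - 2 * sin (a * t) / a + t"
      have "((\<lambda>t. green_coeff k t * green_coeff k t) has_integral (?F 1 - ?F 0)) {0..1}"
      proof (rule fundamental_theorem_of_calculus)
        fix t
        have "(?F has_real_derivative 1 / 2 + (cos (a * t) * cos (a * t) - sin (a * t) * sin (a * t)) / 2 - 2 * cos (a * t) + 1)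
            (at t within {0..1})"
          by (auto intro!: derivative_eq_intros simp: a(1) divide_simps) (simp add: algebra_simps)
        moreover have "1 / 2 + (cos (a * t) * cos (a * t) - sin (a * t) * sin (a * t)) / 2 - 2 * cos (a * t) + 1 = green_coeff k t * green_coeff k t"
          using True by (simp add: green_coeff_def a_def[symmetric] sc) (simp add: field_simps)
        ultimately show "(?F has_vector_derivative green_coeff k t * green_coeff k t) (at t within {0..1})"
          by (simp only: has_real_derivative_iff_has_vector_derivative)
      qed simp
      then show ?thesis using True a by (simp add: integral_unique)
    next
      case False
      \<comment> \<open>For odd \<open>k\<close>, \<open>green_coeff k t\<close> is
        \<open>cos (a * t) + (2 * t - 1)\<close>. The last two terms integrate the cross term by
        parts.\<close>
      let ?F = "\<lambda>t. t / 2 + sin (a * t) * cos (a * t) / (2 * a) + (2 * t - 1) ^ 3 / 6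
          + 2 * (2 * t - 1) * sin (a * t) / a + 4 * cos (a * t) / a\<^sup>2"
      have "((\<lambda>t. green_coeff k t * green_coeff k t) has_integral (?F 1 - ?F 0)) {0..1}"
      proof (rule fundamental_theorem_of_calculus)
        fix t
        have "(?F has_real_derivative 1 / 2 + (cos (a * t) * cos (a * t) - sin (a * t) * sin (a * t)) / 2
            + (2 * t - 1)\<^sup>2 + 2 * (2 * t - 1) * cos (a * t)) (at t within {0..1})"
          by (auto intro!: derivative_eq_intros simp: a(1) divide_simps) (simp add: algebra_simps power2_eq_square)
        moreover have "1 / 2 + (cos (a * t) * cos (a * t) - sin (a * t) * sin (a * t)) / 2
            + (2 * t - 1)\<^sup>2 + 2 * (2 * t - 1) * cos (a * t) = green_coeff k t * green_coeff k t"
          using False by (simp add: green_coeff_def a_def[symmetric] sc) (simp add: field_simps power2_eq_square)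
        ultimately show "(?F has_vector_derivative green_coeff k t * green_coeff k t) (at t within {0..1})"
          by (simp only: has_real_derivative_iff_has_vector_derivative)
      qed simp
      \<comment> \<open>Here \<open>cos a = -1\<close>, so the diagonal value is exactly
        \<open>29 / 6 - 8 / a^2\<close>. The crude \<open>cos a \<le> 1\<close> is enough, because
        the boundary term at 0 is \<open>- 4 / a^2\<close>.\<close>
      moreover have "4 * cos a / a\<^sup>2 \<le> 4 / a\<^sup>2" by (intro divide_right_mono) auto
      ultimately show ?thesis using False a by (simp add: integral_unique)
    qed
  qed
  have "\<bar>integral {0..1} (\<lambda>t. green_coeff k t * green_coeff l t)\<bar>
      \<le> integral {0..1} (\<lambda>t. (green_coeff k t * green_coeff k t) * (1 / 2) + (green_coeff l t * green_coeff l t) * (1 / 2))"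
    unfolding real_norm_def[symmetric]
  proof (rule integral_norm_bound_integral)
    show "norm (green_coeff k t * green_coeff l t) \<le> green_coeff k t * green_coeff k t * (1 / 2) + green_coeff l t * green_coeff l t * (1 / 2)" for t
      using sum_squares_bound[of "\<bar>green_coeff k t\<bar>" "\<bar>green_coeff l t\<bar>"] by (simp add: abs_mult power2_eq_square)
  qed (intro int integrable_add integrable_on_mult_left)+
  also have "\<dots> = integral {0..1} (\<lambda>t. green_coeff k t * green_coeff k t) * (1 / 2) + integral {0..1} (\<lambda>t. green_coeff l t * green_coeff l t) * (1 / 2)"
    by (simp only: integral_mult_left[symmetric]) (intro integral_add int integrable_on_mult_left)
  finally have 1: "\<bar>integral {0..1} (\<lambda>t. green_coeff k t * green_coeff l t)\<bar> \<le> \<dots>" .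
  have 2: "\<bar>(1 - (-1) ^ k) * (1 - (-1) ^ l)\<bar> \<le> (1 - (-1) ^ k)\<^sup>2 / 2 + (1 - (-1) ^ l)\<^sup>2 / (2::real)"
    by (cases "even k"; cases "even l") auto
  show ?thesis
    using 1 2 diag[OF kl(1)] diag[OF kl(2)] abs_triangle_ineq[of "(1 - (-1) ^ k) * (1 - (-1) ^ l)" "integral {0..1} (\<lambda>t. green_coeff k t * green_coeff l t)"]
    unfolding sobolev_coeff_def by linarith
qed

text \<open>Cutting the series of \<open>B_1\<close> and of \<open>green\<close> at the same
  \<open>n\<close> turns the Gram formula into exactly the square partial sum of the double series.
  Its limit follows by dominated convergence in \<open>t\<close>, so no rearrangement of a double
  series occurs.\<close>

lemma sobolev_factor_cosine_series:
  assumes x: "x \<in> {0..1}" and y: "y \<in> {0..1}"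
  shows "(\<lambda>n. \<Sum>k<n. \<Sum>l<n. 4 * sobolev_coeff (Suc k) (Suc l) / ((pi * real (Suc k))\<^sup>2 * (pi * real (Suc l))\<^sup>2)
      * (cos (pi * real (Suc k) * x) * cos (pi * real (Suc l) * y))) \<longlonglongrightarrow> sobolev_factor x y"
proof -
  define w where "w k x = cos (pi * real (Suc k) * x) / (pi * real (Suc k))\<^sup>2" for k x
  define b where "b n x = (\<Sum>k<n. - 2 * (1 - (-1) ^ Suc k) * w k x)" for n x
  define g where "g n x t = (\<Sum>k<n. 2 * green_coeff (Suc k) t * w k x)" for n x t
  have w: "\<bar>w k x\<bar> \<le> 1 / (pi * real (Suc k))\<^sup>2" for k x by (simp add: w_def divide_right_mono)
  have blim: "(\<lambda>n. b n x) \<longlonglongrightarrow> x - 1 / 2" if "x \<in> {0..1}" for x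
    using bernoulli1_series[OF that] by (simp only: sums_def b_def w_def times_divide_eq_right)
  have glim: "(\<lambda>n. g n x t) \<longlonglongrightarrow> green x t" if "x \<in> {0..1}" "t \<in> {0..1}" for x t
    using green_series[OF that] by (simp only: sums_def g_def w_def times_divide_eq_right)
  define B where "B = (\<Sum>k. 4 * (1 / (pi * real (Suc k))\<^sup>2))"
  have gB: "\<bar>g n x t\<bar> \<le> B" if t: "t \<in> {0..1}" for n x t
  proof -
    have "\<bar>g n x t\<bar> \<le> (\<Sum>k<n. 4 * (1 / (pi * real (Suc k))\<^sup>2))"
      unfolding g_def
    proof (rule order_trans[OF sum_abs sum_mono])
      fix k
      have "\<bar>2 * green_coeff (Suc k) t\<bar> * \<bar>w k x\<bar> \<le> 4 * (1 / (pi * real (Suc k))\<^sup>2)"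
        using abs_green_coeff_le[OF t, of "Suc k"] by (intro mult_mono w) (auto simp: abs_mult)
      then show "\<bar>2 * green_coeff (Suc k) t * w k x\<bar> \<le> 4 * (1 / (pi * real (Suc k))\<^sup>2)" by (simp only: abs_mult)
    qed
    also have "\<dots> \<le> B"
      unfolding B_def by (intro sum_le_suminf summable_mult summable_inverse_Suc_squares) auto
    finally show ?thesis .
  qed
  have contg: "continuous_on S (g n x)" for S n x
    unfolding g_def by (intro continuous_intros continuous_on_green_coeff)
  have "(\<lambda>n. integral {0..1} (\<lambda>t. g n x t * g n y t)) \<longlonglongrightarrow> integral {0..1} (\<lambda>t. green x t * green y t)"
  proof (rule dominated_convergence(2))
    show "(\<lambda>t. g n x t * g n y t) integrable_on {0..1}" for n
      by (intro integrable_continuous_real continuous_on_mult contg)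
    show "(\<lambda>t::real. B * B) integrable_on {0..1}" by (intro integrable_continuous_real continuous_intros)
    show "norm (g n x t * g n y t) \<le> B * B" if "t \<in> {0..1}" for n t
      using gB[OF that, of n x] gB[OF that, of n y] by (auto simp: abs_mult intro!: mult_mono)
    show "(\<lambda>n. g n x t * g n y t) \<longlonglongrightarrow> green x t * green y t" if "t \<in> {0..1}" for t
      by (intro tendsto_mult glim x y that)
  qed
  then have "(\<lambda>n. b n x * b n y + integral {0..1} (\<lambda>t. g n x t * g n y t)) \<longlonglongrightarrow> sobolev_factor x y"
    using tendsto_add[OF tendsto_mult[OF blim[OF x] blim[OF y]]] integral_green_green[OF x y] by fastforce
  moreover have "b n x * b n y + integral {0..1} (\<lambda>t. g n x t * g n y t)
      = (\<Sum>k<n. \<Sum>l<n. 4 * sobolev_coeff (Suc k) (Suc l) / ((pi * real (Suc k))\<^sup>2 * (pi * real (Suc l))\<^sup>2)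
      * (cos (pi * real (Suc k) * x) * cos (pi * real (Suc l) * y)))" for n
  proof -
    have "integral {0..1} (\<lambda>t. g n x t * g n y t)
        = integral {0..1} (\<lambda>t. \<Sum>k<n. \<Sum>l<n. (4 * w k x * w l y) * (green_coeff (Suc k) t * green_coeff (Suc l) t))"
      by (simp add: g_def sum_product mult_ac)
    also have "\<dots> = (\<Sum>k<n. \<Sum>l<n. (4 * w k x * w l y) * integral {0..1} (\<lambda>t. green_coeff (Suc k) t * green_coeff (Suc l) t))"
      by (subst integral_sum, simp,
          intro integrable_sum integrable_on_mult_right integrable_continuous_real continuous_intros continuous_on_green_coeff finite_lessThan,
          intro sum.cong refl, subst integral_sum, simp,
          intro integrable_on_mult_right integrable_continuous_real continuous_intros continuous_on_green_coeff,
          simp only: integral_mult_right)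
    finally have "b n x * b n y + integral {0..1} (\<lambda>t. g n x t * g n y t)
        = (\<Sum>k<n. \<Sum>l<n. 4 * w k x * w l y * sobolev_coeff (Suc k) (Suc l))"
      by (simp add: b_def sobolev_coeff_def sum_product sum.distrib[symmetric] algebra_simps)
    then show ?thesis by (simp add: w_def mult_ac)
  qed
  ultimately show ?thesis by simp
qed

section \<open>Character sums over lattice points\<close>

definition nonzero_ints :: "nat \<Rightarrow> int set" where
  "nonzero_ints n = {- int n..int n} - {0}"

lemma finite_nonzero_ints [simp]: "finite (nonzero_ints n)" by (simp add: nonzero_ints_def)

text \<open>Pairs \<open>h\<close> with \<open>- h\<close>. It links the real cosine sums of the
  kernels with the characters whose lattice sums are computable.\<close>

lemma sum_nonzero_ints:
  "(\<Sum>h\<in>nonzero_ints n. complex_of_real (f (nat \<bar>h\<bar>)) * cis (2 * pi * (of_int h * t)))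
    = complex_of_real (\<Sum>k<n. f (Suc k) * (2 * cos (2 * pi * real (Suc k) * t)))"
proof (induction n)
  case (Suc n)
  have Z: "nonzero_ints (Suc n) = insert (int (Suc n)) (insert (- int (Suc n)) (nonzero_ints n))" by (auto simp: nonzero_ints_def)
  have n: "int (Suc n) \<noteq> - int (Suc n)" "int (Suc n) \<notin> nonzero_ints n" "- int (Suc n) \<notin> nonzero_ints n" by (auto simp: nonzero_ints_def)
  have "cis (2 * pi * (of_int (int (Suc n)) * t)) + cis (2 * pi * (of_int (- int (Suc n)) * t))
      = complex_of_real (2 * cos (2 * pi * real (Suc n) * t))"
    by (simp add: complex_eq_iff mult.assoc del: of_nat_Suc)
  moreover have "nat \<bar>int (Suc n)\<bar> = Suc n" "nat \<bar>- int (Suc n)\<bar> = Suc n" by simp_all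
  ultimately show ?case
    unfolding Z using n Suc
    by (simp add: distrib_left[symmetric] add.assoc[symmetric] del: of_nat_Suc)
qed (simp add: nonzero_ints_def)

text \<open>Finite sets that eventually contain each point eventually contain each finite set, so
  they converge along the filter that defines the infinite sum.\<close>

lemma infsum_limit_exhaustion:
  fixes f :: "'a \<Rightarrow> 'b :: {comm_monoid_add, t2_space}"
  assumes f: "f summable_on A" and B: "\<And>n. finite (B n)" "\<And>n. B n \<subseteq> A"
    and ex: "\<And>x. x \<in> A \<Longrightarrow> eventually (\<lambda>n. x \<in> B n) sequentially"
  shows "(\<lambda>n. sum f (B n)) \<longlonglongrightarrow> infsum f A"
proof -
  have "filterlim B (finite_subsets_at_top A) sequentially"
    unfolding filterlim_finite_subsets_at_top
  proof (intro allI impI)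
    fix X assume X: "finite X \<and> X \<subseteq> A"
    then have "\<forall>\<^sub>F n in sequentially. \<forall>x\<in>X. x \<in> B n"
      using ex by (intro eventually_ball_finite) auto
    then show "\<forall>\<^sub>F n in sequentially. finite (B n) \<and> X \<subseteq> B n \<and> B n \<subseteq> A"
      by eventually_elim (use B in auto)
  qed
  moreover have "(sum f \<longlongrightarrow> infsum f A) (finite_subsets_at_top A)"
    using has_sum_infsum[OF f] by (simp add: has_sum_def)
  ultimately show ?thesis by (rule filterlim_compose[rotated])
qed

lemma eventually_mem_nonzero_ints: "h \<noteq> 0 \<Longrightarrow> eventually (\<lambda>n. h \<in> nonzero_ints n) sequentially"
  using eventually_ge_at_top[of "nat \<bar>h\<bar>"] by eventually_elim (auto simp: nonzero_ints_def)

lemma summable_on_inverse_squares: "(\<lambda>h. 1 / (real_of_int h)\<^sup>2) summable_on (UNIV - {0})"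
proof -
  have "summable (\<lambda>n. norm (1 / (real (Suc n))\<^sup>2))"
    using sums_summable[OF inverse_squares_sums] by (simp add: add.commute)
  then have s: "(\<lambda>n. 1 / (real (Suc n))\<^sup>2) summable_on UNIV" by (rule norm_summable_imp_summable_on)
  have 1: "(\<lambda>h. 1 / (real_of_int h)\<^sup>2) summable_on range (\<lambda>n. int (Suc n))"
    using s by (subst summable_on_reindex) (auto simp: inj_def o_def)
  have 2: "(\<lambda>h. 1 / (real_of_int h)\<^sup>2) summable_on range (\<lambda>n. - int (Suc n))"
  proof (subst summable_on_reindex)
    have "(real_of_int (- int (Suc n)))\<^sup>2 = (real (Suc n))\<^sup>2" for n by (simp del: of_nat_Suc)
    then show "(\<lambda>h. 1 / (real_of_int h)\<^sup>2) \<circ> (\<lambda>n. - int (Suc n)) summable_on UNIV"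
      using s by (simp only: o_def)
  qed (auto simp: inj_def)
  have "UNIV - {0} = range (\<lambda>n. int (Suc n)) \<union> range (\<lambda>n. - int (Suc n))"
  proof (intro equalityI subsetI)
    fix h :: int assume "h \<in> UNIV - {0}"
    then have "h = int (Suc (nat h - 1)) \<or> h = - int (Suc (nat (- h) - 1))" by auto
    then show "h \<in> range (\<lambda>n. int (Suc n)) \<union> range (\<lambda>n. - int (Suc n))" by blast
  qed auto
  moreover have "range (\<lambda>n. int (Suc n)) \<inter> range (\<lambda>n. - int (Suc n)) = {}" by auto
  ultimately show ?thesis using summable_on_Un_disjoint[OF 1 2] by simp
qed

text \<open>The congruence is dropped and a finite set of frequencies is enclosed in the product of
  its coordinate projections. There the sum factorises and is at most \<open>S\<close> to the power
  \<open>card u\<close>.\<close>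

lemma summable_on_dual_lattice:
  fixes z :: "nat ^ 's::finite"
  shows "(\<lambda>k. \<Prod>j\<in>u. 1 / (real_of_int (k j))\<^sup>2) summable_on dual_lattice N z u"
proof (rule nonneg_bdd_above_summable_on)
  define S where "S = infsum (\<lambda>h. 1 / (real_of_int h)\<^sup>2) (UNIV - {0})"
  show "bdd_above (sum (\<lambda>k. \<Prod>j\<in>u. 1 / (real_of_int (k j))\<^sup>2) ` {F. F \<subseteq> dual_lattice N z u \<and> finite F})"
  proof (rule bdd_aboveI2)
    fix F assume "F \<in> {F. F \<subseteq> dual_lattice N z u \<and> finite F}"
    then have F: "F \<subseteq> u \<rightarrow>\<^sub>E (UNIV - {0})" "finite F" by (auto simp: dual_lattice_def)
    define B where "B j = (\<lambda>k. k j) ` F" for j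
    have B: "finite (B j)" for j using F by (simp add: B_def)
    have "(\<Sum>k\<in>F. \<Prod>j\<in>u. 1 / (real_of_int (k j))\<^sup>2) \<le> (\<Sum>k\<in>Pi\<^sub>E u B. \<Prod>j\<in>u. 1 / (real_of_int (k j))\<^sup>2)"
      by (rule sum_mono2) (use F in \<open>auto simp: B_def PiE_iff intro!: finite_PiE prod_nonneg\<close>)
    also have "\<dots> = (\<Prod>j\<in>u. \<Sum>h\<in>B j. 1 / (real_of_int h)\<^sup>2)"
      by (rule prod_sum_PiE[symmetric]) (auto simp: B)
    also have "\<dots> \<le> (\<Prod>j\<in>u. S)"
      unfolding S_def
      by (intro prod_mono conjI sum_nonneg finite_sum_le_infsum summable_on_inverse_squares)
         (use F in \<open>auto simp: B_def PiE_iff\<close>)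
    finally show "(\<Sum>k\<in>F. \<Prod>j\<in>u. 1 / (real_of_int (k j))\<^sup>2) \<le> (\<Prod>j\<in>u. S)" .
  qed
qed (auto intro!: prod_nonneg)

section \<open>Characters on the lattice and its dual\<close>

definition lattice_point :: "nat \<Rightarrow> nat ^ 's \<Rightarrow> nat \<Rightarrow> real ^ 's" where
  "lattice_point N z n = (\<chi> j. frac (real n * real (z $ j) / real N))"

lemma cis_frac: "cis (2 * pi * (of_int k * frac r)) = cis (2 * pi * (of_int k * r))"
proof -
  have "2 * pi * (of_int k * r) = 2 * pi * (of_int k * frac r) + 2 * pi * of_int (k * \<lfloor>r\<rfloor>)"
    by (simp add: frac_def algebra_simps)
  then have "cis (2 * pi * (of_int k * r)) = cis (2 * pi * (of_int k * frac r)) * cis (2 * pi * of_int (k * \<lfloor>r\<rfloor>))"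
    by (simp only: cis_mult)
  also have "cis (2 * pi * of_int (k * \<lfloor>r\<rfloor>)) = 1" by (intro cis_multiple_2pi Ints_of_int)
  finally show ?thesis by simp
qed

lemma prod_cis: "finite A \<Longrightarrow> (\<Prod>j\<in>A. cis (f j)) = cis (\<Sum>j\<in>A. f j)"
  by (induction A rule: finite_induct) (auto simp: cis_mult)

text \<open>Integer frequencies ignore the fractional part, so this is a geometric sum of powers of
  an \<open>N\<close>-th root of unity \<open>w\<close>, and \<open>w = 1\<close> exactly when the
  congruence holds.\<close>

lemma lattice_character_sum:
  fixes z :: "nat ^ 's::finite"
  assumes N: "N > 0"
  shows "(\<Sum>n<N. \<Prod>j\<in>u. cis (2 * pi * (of_int (k j) * (lattice_point N z n $ j))))
    = (if [(\<Sum>j\<in>u. k j * int (z $ j)) = 0] (mod int N) then of_nat N else 0)"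
proof -
  define S where "S = (\<Sum>j\<in>u. k j * int (z $ j))"
  define w where "w = cis (2 * pi * (of_int S / real N))"
  have "(\<Prod>j\<in>u. cis (2 * pi * (of_int (k j) * (lattice_point N z n $ j)))) = w ^ n" for n
  proof -
    have "(\<Prod>j\<in>u. cis (2 * pi * (of_int (k j) * (lattice_point N z n $ j))))
        = cis (\<Sum>j\<in>u. 2 * pi * (of_int (k j) * (real n * real (z $ j) / real N)))"
      by (simp only: lattice_point_def vec_lambda_beta cis_frac prod_cis finite)
    also have "(\<Sum>j\<in>u. 2 * pi * (of_int (k j) * (real n * real (z $ j) / real N)))
        = real n * (2 * pi * (of_int S / real N))"
      by (simp add: S_def sum_distrib_left sum_divide_distrib mult_ac)
    finally show ?thesis by (simp only: w_def Complex.DeMoivre)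
  qed
  then have sum: "(\<Sum>n<N. \<Prod>j\<in>u. cis (2 * pi * (of_int (k j) * (lattice_point N z n $ j)))) = (\<Sum>n<N. w ^ n)"
    by simp
  have wN: "w ^ N = 1"
  proof -
    have "w ^ N = cis (2 * pi * of_int S)" using N by (simp add: w_def Complex.DeMoivre)
    then show ?thesis by simp
  qed
  have w1: "w = 1 \<longleftrightarrow> [S = 0] (mod int N)"
  proof
    assume "w = 1"
    then have "cos (2 * pi * (of_int S / real N)) = 1" by (simp add: w_def complex_eq_iff)
    then obtain m :: int where "2 * pi * (of_int S / real N) = of_int m * (2 * pi)"
      unfolding cos_one_2pi_int by (auto simp: mult_ac)
    then have "of_int S = real_of_int m * real N" using N by (simp add: field_simps)
    then have "S = m * int N" by (metis of_int_eq_iff of_int_mult of_int_of_nat_eq)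
    then show "[S = 0] (mod int N)" by (simp add: cong_0_iff)
  next
    assume "[S = 0] (mod int N)"
    then obtain m where m: "S = int N * m" by (auto simp: cong_0_iff)
    then have "of_int S / real N = of_int m" using N by simp
    then show "w = 1" by (simp add: w_def)
  qed
  show ?thesis
  proof (cases "w = 1")
    case True
    then show ?thesis using w1 by (simp add: sum S_def)
  next
    case False
    then have "(\<Sum>n<N. w ^ n) = 0" using wN by (simp add: sum_gp_strict)
    then show ?thesis using w1 False by (simp add: sum S_def)
  qed
qed

definition dual_box :: "nat \<Rightarrow> nat ^ 's \<Rightarrow> 's set \<Rightarrow> nat \<Rightarrow> ('s \<Rightarrow> int) set" where
  "dual_box N z u n = {k \<in> u \<rightarrow>\<^sub>E nonzero_ints n. [(\<Sum>j\<in>u. k j * int (z $ j)) = 0] (mod int N)}"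

lemma finite_dual_box [simp]: "finite (dual_box N z u n)" for z :: "nat ^ 's::finite"
  unfolding dual_box_def by (rule finite_subset[of _ "u \<rightarrow>\<^sub>E nonzero_ints n"]) (auto intro!: finite_PiE)

lemma dual_box_subset: "dual_box N z u n \<subseteq> dual_lattice N z u"
  by (auto simp: dual_box_def dual_lattice_def nonzero_ints_def PiE_iff)

lemma dual_box_limit:
  fixes z :: "nat ^ 's::finite"
  shows "(\<lambda>n. \<Sum>k\<in>dual_box N z u n. \<Prod>j\<in>u. 1 / (real_of_int (k j))\<^sup>2)
    \<longlonglongrightarrow> (\<Sum>\<^sub>\<infinity>k \<in> dual_lattice N z u. \<Prod>j\<in>u. 1 / (real_of_int (k j))\<^sup>2)"
proof (rule infsum_limit_exhaustion[OF summable_on_dual_lattice finite_dual_box dual_box_subset])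
  fix k assume k: "k \<in> dual_lattice N z u"
  then have "\<forall>\<^sub>F n in sequentially. \<forall>j\<in>u. k j \<in> nonzero_ints n"
    by (intro eventually_ball_finite) (auto simp: dual_lattice_def PiE_iff intro!: eventually_mem_nonzero_ints)
  then show "\<forall>\<^sub>F n in sequentially. k \<in> dual_box N z u n"
    by eventually_elim (use k in \<open>auto simp: dual_box_def dual_lattice_def PiE_iff\<close>)
qed

text \<open>After the product is expanded, the sums over \<open>a\<close> and \<open>b\<close>
  decouple into two character sums. The coefficients \<open>c\<close> are arbitrary so that the
  diagonal Korobov case and the full Sobolev case are both covered.\<close>

lemma double_lattice_sum:
  fixes z :: "nat ^ 's::finite" and c :: "int \<Rightarrow> int \<Rightarrow> complex"
  assumes N: "N > 0"
  shows "(\<Sum>a<N. \<Sum>b<N. \<Prod>l\<in>u. \<Sum>k\<in>nonzero_ints n. \<Sum>m\<in>nonzero_ints n. c k m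
        * (cis (2 * pi * (of_int k * (lattice_point N z a $ l))) * cis (2 * pi * (of_int m * (lattice_point N z b $ l)))))
    = (of_nat N)\<^sup>2 * (\<Sum>k\<in>dual_box N z u n. \<Sum>m\<in>dual_box N z u n. \<Prod>l\<in>u. c (k l) (m l))"
proof -
  let ?P = "u \<rightarrow>\<^sub>E nonzero_ints n"
  define e where "e a k = (\<Prod>l\<in>u. cis (2 * pi * (of_int (k l) * (lattice_point N z a $ l))))" for a k
  have fin: "finite ?P" by (intro finite_PiE) auto
  have "(\<Prod>l\<in>u. \<Sum>k\<in>nonzero_ints n. \<Sum>m\<in>nonzero_ints n. c k m
        * (cis (2 * pi * (of_int k * (lattice_point N z a $ l))) * cis (2 * pi * (of_int m * (lattice_point N z b $ l)))))
      = (\<Sum>k\<in>?P. \<Sum>m\<in>?P. (\<Prod>l\<in>u. c (k l) (m l)) * (e a k * e b m))" for a b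
    by (subst prod_sum_PiE, simp, simp, rule sum.cong[OF refl], subst prod_sum_PiE, simp, simp)
       (simp add: e_def prod.distrib)
  then have "(\<Sum>a<N. \<Sum>b<N. \<Prod>l\<in>u. \<Sum>k\<in>nonzero_ints n. \<Sum>m\<in>nonzero_ints n. c k m
        * (cis (2 * pi * (of_int k * (lattice_point N z a $ l))) * cis (2 * pi * (of_int m * (lattice_point N z b $ l)))))
      = (\<Sum>a<N. \<Sum>b<N. \<Sum>k\<in>?P. \<Sum>m\<in>?P. (\<Prod>l\<in>u. c (k l) (m l)) * (e a k * e b m))"
    by simp
  also have "\<dots> = (\<Sum>a<N. \<Sum>k\<in>?P. \<Sum>b<N. \<Sum>m\<in>?P. (\<Prod>l\<in>u. c (k l) (m l)) * (e a k * e b m))"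
    by (intro sum.cong refl sum.swap)
  also have "\<dots> = (\<Sum>k\<in>?P. \<Sum>a<N. \<Sum>m\<in>?P. \<Sum>b<N. (\<Prod>l\<in>u. c (k l) (m l)) * (e a k * e b m))"
    by (subst sum.swap) (intro sum.cong refl sum.swap)
  also have "\<dots> = (\<Sum>k\<in>?P. \<Sum>m\<in>?P. \<Sum>a<N. \<Sum>b<N. (\<Prod>l\<in>u. c (k l) (m l)) * (e a k * e b m))"
    by (intro sum.cong refl sum.swap)
  also have "\<dots> = (\<Sum>k\<in>?P. \<Sum>m\<in>?P. (\<Prod>l\<in>u. c (k l) (m l)) * ((\<Sum>a<N. e a k) * (\<Sum>b<N. e b m)))"
    unfolding sum_product by (simp only: sum_distrib_left)
  also have "\<dots> = (\<Sum>k\<in>?P. \<Sum>m\<in>?P. if k \<in> dual_box N z u n \<and> m \<in> dual_box N z u n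
      then (of_nat N)\<^sup>2 * (\<Prod>l\<in>u. c (k l) (m l)) else 0)"
    unfolding e_def lattice_character_sum[OF N]
    by (intro sum.cong refl) (auto simp: dual_box_def power2_eq_square)
  also have "\<dots> = (\<Sum>k\<in>?P. if k \<in> dual_box N z u n then
      (\<Sum>m\<in>?P. if m \<in> dual_box N z u n then (of_nat N)\<^sup>2 * (\<Prod>l\<in>u. c (k l) (m l)) else 0) else 0)"
    by (intro sum.cong refl) auto
  also have "\<dots> = (\<Sum>k\<in>?P \<inter> dual_box N z u n. \<Sum>m\<in>?P \<inter> dual_box N z u n. (of_nat N)\<^sup>2 * (\<Prod>l\<in>u. c (k l) (m l)))"
    by (simp only: sum.inter_restrict[OF fin])
  also have "?P \<inter> dual_box N z u n = dual_box N z u n" by (auto simp: dual_box_def)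
  finally show ?thesis by (simp only: sum_distrib_left)
qed

section \<open>Averages of the kernels over lattice points\<close>

lemma has_integral_abs_diff:
  assumes Q: "\<And>t. (Q has_real_derivative p t) (at t)" and s: "s \<in> {0..1}"
  shows "((\<lambda>t. p \<bar>s - t\<bar>) has_integral (Q s + Q (1 - s) - 2 * Q 0)) {0..1}"
proof -
  have "((\<lambda>t. p (s - t)) has_integral (- Q (s - s) - (- Q (s - 0)))) {0..s}"
    by (rule fundamental_theorem_of_calculus)
       (use s in \<open>auto intro!: derivative_eq_intros DERIV_chain2[OF Q] simp: has_real_derivative_iff_has_vector_derivative[symmetric]\<close>)
  then have 1: "((\<lambda>t. p \<bar>s - t\<bar>) has_integral (- Q (s - s) - (- Q (s - 0)))) {0..s}"
    by (rule has_integral_eq[rotated]) auto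
  have "((\<lambda>t. Q (t - s)) has_real_derivative p (t - s) * 1) (at t within {s..1})" for t
    by (rule DERIV_chain2[OF Q]) (auto intro!: derivative_eq_intros)
  then have "((\<lambda>t. p (t - s)) has_integral (Q (1 - s) - Q (s - s))) {s..1}"
    by (intro fundamental_theorem_of_calculus)
       (use s in \<open>simp_all add: has_real_derivative_iff_has_vector_derivative[symmetric]\<close>)
  then have 2: "((\<lambda>t. p \<bar>s - t\<bar>) has_integral (Q (1 - s) - Q (s - s))) {s..1}"
    by (rule has_integral_eq[rotated]) auto
  show ?thesis
    using has_integral_combine[OF _ _ 1 2] s by simp
qed

lemma integral_sobolev_factor:
  assumes s: "s \<in> {0..1}"
  shows "integral {0..1} (sobolev_factor s) = 0"
proof -
  have 1: "((\<lambda>t. t - 1 / 2) has_integral ((1\<^sup>2 / 2 - 1 / 2) - (0\<^sup>2 / 2 - 0 / 2 :: real))) {0..1}"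
    by (rule fundamental_theorem_of_calculus)
       (auto intro!: derivative_eq_intros simp: has_real_derivative_iff_has_vector_derivative[symmetric])
  have 2: "((\<lambda>t. t\<^sup>2 - t + 1 / 6) has_integral ((1 ^ 3 / 3 - 1\<^sup>2 / 2 + 1 / 6) - (0 ^ 3 / 3 - 0\<^sup>2 / 2 + 0 / 6 :: real))) {0..1}"
    by (rule fundamental_theorem_of_calculus)
       (auto intro!: derivative_eq_intros simp: has_real_derivative_iff_has_vector_derivative[symmetric])
  \<comment> \<open>This is \<open>B_5(r) / 5\<close>; the integral vanishes because
    \<open>B_5\<close> is odd about 1/2 and zero at 0.\<close>
  define Q where "Q r = r ^ 5 / 5 - r ^ 4 / 2 + r ^ 3 / 3 - r / 30" for r :: real
  have "(Q has_real_derivative r ^ 4 - 2 * r ^ 3 + r\<^sup>2 - 1 / 30) (at r)" for r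
    unfolding Q_def[abs_def] by (auto intro!: derivative_eq_intros)
  from has_integral_abs_diff[OF this s]
  have 3: "((\<lambda>t. \<bar>s - t\<bar> ^ 4 - 2 * \<bar>s - t\<bar> ^ 3 + \<bar>s - t\<bar>\<^sup>2 - 1 / 30) has_integral (Q s + Q (1 - s) - 2 * Q 0)) {0..1}" .
  have "((\<lambda>t. (s - 1 / 2) * (t - 1 / 2) + (s\<^sup>2 - s + 1 / 6) * (t\<^sup>2 - t + 1 / 6) / 4
      - (\<bar>s - t\<bar> ^ 4 - 2 * \<bar>s - t\<bar> ^ 3 + \<bar>s - t\<bar>\<^sup>2 - 1 / 30) / 24) has_integral
      ((s - 1 / 2) * ((1\<^sup>2 / 2 - 1 / 2) - (0\<^sup>2 / 2 - 0 / 2))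
       + (s\<^sup>2 - s + 1 / 6) * ((1 ^ 3 / 3 - 1\<^sup>2 / 2 + 1 / 6) - (0 ^ 3 / 3 - 0\<^sup>2 / 2 + 0 / 6)) / 4
       - (Q s + Q (1 - s) - 2 * Q 0) / 24)) {0..1}"
    by (intro has_integral_diff has_integral_add has_integral_mult_right has_integral_divide 1 2 3)
  moreover have "Q s + Q (1 - s) - 2 * Q 0 = 0"
    by (simp add: Q_def eval_nat_numeral field_simps)
  ultimately show ?thesis
    by (intro integral_unique) (simp add: sobolev_factor_eq[abs_def])
qed

lemma continuous_on_sobolev_factor: "continuous_on S (\<lambda>(s, t). sobolev_factor s t)"
  unfolding sobolev_factor_eq case_prod_beta by (intro continuous_intros) auto

lemma korobov_sum_limit:
  "(\<lambda>n. \<Sum>k<n. 1 / (real (Suc k))\<^sup>2 * (2 * cos (2 * pi * real (Suc k) * t))) \<longlonglongrightarrow> korobov_sum 1 t"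
proof -
  define g where "g h = exp (2 * complex_of_real pi * \<i> * of_int h * complex_of_real t)
      / complex_of_real (\<bar>real_of_int h\<bar> powr (2 * 1))" for h :: int
  have g: "g h = complex_of_real (1 / (real (nat \<bar>h\<bar>))\<^sup>2) * cis (2 * pi * (of_int h * t))" if "h \<noteq> 0" for h
    using that by (simp add: g_def cis_conv_exp mult_ac powr_numeral)
  have "(\<lambda>h. norm (g h)) summable_on (UNIV - {0})"
    by (rule summable_on_cong[THEN iffD1, OF _ summable_on_inverse_squares]) (simp add: g norm_mult norm_divide norm_power)
  then have "g summable_on (UNIV - {0})" by (rule abs_summable_summable)
  then have "(\<lambda>n. sum g (nonzero_ints n)) \<longlonglongrightarrow> infsum g (UNIV - {0})"
  proof (rule infsum_limit_exhaustion)
    show "nonzero_ints n \<subseteq> UNIV - {0}" for n by (auto simp: nonzero_ints_def)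
  qed (auto intro: eventually_mem_nonzero_ints)
  moreover have "sum g (nonzero_ints n) = complex_of_real (\<Sum>k<n. 1 / (real (Suc k))\<^sup>2 * (2 * cos (2 * pi * real (Suc k) * t)))" for n
    unfolding sum_nonzero_ints[where f = "\<lambda>k. 1 / (real k)\<^sup>2", symmetric]
    by (rule sum.cong[OF refl], rule g) (simp add: nonzero_ints_def)
  ultimately have "(\<lambda>n. Re (complex_of_real (\<Sum>k<n. 1 / (real (Suc k))\<^sup>2 * (2 * cos (2 * pi * real (Suc k) * t)))))
      \<longlonglongrightarrow> Re (infsum g (UNIV - {0}))"
    by (intro tendsto_Re) simp
  then show ?thesis by (simp only: korobov_sum_def g_def[symmetric] Re_complex_of_real)
qed

text \<open>The series of \<open>bern2\<close> at \<open>2 * \<bar>t\<bar>\<close>, which is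
  \<open>B_2(\<bar>t\<bar>)\<close>. The closed form makes continuity and the vanishing integral
  accessible.\<close>

lemma korobov_sum_eq:
  assumes "\<bar>t\<bar> \<le> 1"
  shows "korobov_sum 1 t = 2 * pi\<^sup>2 * (\<bar>t\<bar>\<^sup>2 - \<bar>t\<bar> + 1 / 6)"
proof -
  have "(\<lambda>k. 2 * pi\<^sup>2 * (cos (pi * real (Suc k) * (2 * \<bar>t\<bar>)) / (pi * real (Suc k))\<^sup>2)) sums (2 * pi\<^sup>2 * bern2 (2 * \<bar>t\<bar>))"
    using assms by (intro sums_mult bern2_cosine_series) auto
  moreover have "2 * pi\<^sup>2 * (cos (pi * real (Suc k) * (2 * \<bar>t\<bar>)) / (pi * real (Suc k))\<^sup>2)
      = 1 / (real (Suc k))\<^sup>2 * (2 * cos (2 * pi * real (Suc k) * t))" for k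
  proof -
    have "\<bar>2 * pi * real (Suc k) * t\<bar> = pi * real (Suc k) * (2 * \<bar>t\<bar>)" by (simp add: abs_mult)
    then have "cos (pi * real (Suc k) * (2 * \<bar>t\<bar>)) = cos (2 * pi * real (Suc k) * t)"
      by (metis cos_abs_real)
    then show ?thesis by (simp add: power_mult_distrib del: of_nat_Suc)
  qed
  ultimately have "korobov_sum 1 t = 2 * pi\<^sup>2 * bern2 (2 * \<bar>t\<bar>)"
    using LIMSEQ_unique[OF korobov_sum_limit] by (simp only: sums_def)
  then show ?thesis by (simp add: bern2_def)
qed

lemma integral_korobov_sum:
  assumes s: "s \<in> {0..1}"
  shows "integral {0..1} (\<lambda>t. korobov_sum 1 (s - t)) = 0"
proof -
  \<comment> \<open>A multiple of \<open>B_3(r) / 3\<close>, which is likewise odd about 1/2 and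
    zero at 0.\<close>
  define Q where "Q r = 2 * pi\<^sup>2 * (r ^ 3 / 3 - r\<^sup>2 / 2 + r / 6)" for r :: real
  have "(Q has_real_derivative 2 * pi\<^sup>2 * (r\<^sup>2 - r + 1 / 6)) (at r)" for r
    unfolding Q_def[abs_def] by (auto intro!: derivative_eq_intros)
  from has_integral_abs_diff[OF this s]
  have "((\<lambda>t. 2 * pi\<^sup>2 * (\<bar>s - t\<bar>\<^sup>2 - \<bar>s - t\<bar> + 1 / 6)) has_integral (Q s + Q (1 - s) - 2 * Q 0)) {0..1}" .
  then have "((\<lambda>t. korobov_sum 1 (s - t)) has_integral (Q s + Q (1 - s) - 2 * Q 0)) {0..1}"
    by (rule has_integral_eq[rotated]) (use s in \<open>auto simp: korobov_sum_eq abs_le_iff\<close>)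
  moreover have "Q s + Q (1 - s) - 2 * Q 0 = 0"
    by (simp add: Q_def eval_nat_numeral field_simps)
  ultimately show ?thesis by (simp add: integral_unique)
qed

lemma continuous_on_korobov_sum: "continuous_on ({0..1} \<times> {0..1}) (\<lambda>(s, t). korobov_sum 1 (s - t))"
proof (rule continuous_on_eq)
  show "continuous_on ({0..1} \<times> {0..1}) (\<lambda>z. 2 * pi\<^sup>2 * (\<bar>fst z - snd z\<bar>\<^sup>2 - \<bar>fst z - snd z\<bar> + 1 / 6))"
    by (intro continuous_intros)
qed (auto simp: korobov_sum_eq abs_le_iff)

lemma lattice_point_in: "lattice_point N z n $ j \<in> {0..1}"
  by (simp add: lattice_point_def less_imp_le[OF frac_lt_1])

text \<open>The factor depends on \<open>s - t\<close> alone, so only frequency pairs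
  \<open>(h, - h)\<close> occur. The dual lattice is closed under negation, hence the double sum
  over it collapses to a single sum.\<close>

lemma korobov_lattice_average:
  fixes z :: "nat ^ 's::finite"
  assumes N: "N > 0"
  shows "(\<Sum>a<N. \<Sum>b<N. \<Prod>l\<in>u. korobov_sum 1 (lattice_point N z a $ l - lattice_point N z b $ l)) / (real N)\<^sup>2
    = (\<Sum>\<^sub>\<infinity>k \<in> dual_lattice N z u. \<Prod>j\<in>u. 1 / (real_of_int (k j))\<^sup>2)"
proof -
  let ?w = "\<lambda>k. \<Prod>j\<in>u. 1 / (real_of_int (k j))\<^sup>2"
  define kn where "kn n t = (\<Sum>k<n. 1 / (real (Suc k))\<^sup>2 * (2 * cos (2 * pi * real (Suc k) * t)))" for n t
  define c where "c h m = (if m = - h then complex_of_real (1 / (real_of_int h)\<^sup>2) else 0)" for h m :: int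
  have kn: "complex_of_real (kn n (s - t)) = (\<Sum>k\<in>nonzero_ints n. \<Sum>m\<in>nonzero_ints n. c k m
        * (cis (2 * pi * (of_int k * s)) * cis (2 * pi * (of_int m * t))))" for n s t
    unfolding kn_def sum_nonzero_ints[where f = "\<lambda>k. 1 / (real k)\<^sup>2", symmetric]
  proof (rule sum.cong[OF refl])
    fix k assume k: "k \<in> nonzero_ints n"
    have "(\<Sum>m\<in>nonzero_ints n. c k m * (cis (2 * pi * (of_int k * s)) * cis (2 * pi * (of_int m * t))))
       = (\<Sum>m\<in>nonzero_ints n. if m = - k then complex_of_real (1 / (real_of_int k)\<^sup>2)
            * (cis (2 * pi * (of_int k * s)) * cis (2 * pi * (of_int m * t))) else 0)"
      by (rule sum.cong) (auto simp: c_def)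
    also have "\<dots> = complex_of_real (1 / (real_of_int k)\<^sup>2)
            * (cis (2 * pi * (of_int k * s)) * cis (2 * pi * (of_int (- k) * t)))"
      using k by (simp add: nonzero_ints_def)
    also have "\<dots> = complex_of_real (1 / (real (nat \<bar>k\<bar>))\<^sup>2) * cis (2 * pi * (of_int k * (s - t)))"
      by (simp add: cis_mult algebra_simps)
    finally show "complex_of_real (1 / (real (nat \<bar>k\<bar>))\<^sup>2) * cis (2 * pi * (of_int k * (s - t)))
      = (\<Sum>m\<in>nonzero_ints n. c k m * (cis (2 * pi * (of_int k * s)) * cis (2 * pi * (of_int m * t))))" by simp
  qed
  have box: "(\<Sum>m\<in>dual_box N z u n. \<Prod>l\<in>u. c (k l) (m l)) = complex_of_real (?w k)"
    if k: "k \<in> dual_box N z u n" for k n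
  proof -
    \<comment> \<open>The negated frequency; \<open>restrict\<close> keeps it extensional, as
      membership in \<open>dual_box\<close> demands.\<close>
    define k' where "k' = restrict (\<lambda>l. - k l) u"
    have "(\<Sum>j\<in>u. k' j * int (z $ j)) = - (\<Sum>j\<in>u. k j * int (z $ j))"
      by (simp add: k'_def sum_negf)
    then have k': "k' \<in> dual_box N z u n"
      using k by (auto simp: dual_box_def k'_def PiE_iff nonzero_ints_def cong_0_iff)
    have "(\<Prod>l\<in>u. c (k l) (m l)) = (if m = k' then complex_of_real (?w k) else 0)"
      if m: "m \<in> dual_box N z u n" for m
    proof (cases "m = k'")
      case False
      have "m \<in> extensional u" "k' \<in> extensional u" using m k' by (auto simp: dual_box_def PiE_iff)
      then obtain l where "l \<in> u" "m l \<noteq> k' l" using False extensionalityI by metis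
      then show ?thesis using False by (auto simp: c_def k'_def intro!: prod_zero bexI[of _ l])
    qed (auto simp: c_def k'_def)
    then have "(\<Sum>m\<in>dual_box N z u n. \<Prod>l\<in>u. c (k l) (m l))
        = (\<Sum>m\<in>dual_box N z u n. if m = k' then complex_of_real (?w k) else 0)"
      by (intro sum.cong) auto
    also have "\<dots> = complex_of_real (?w k)" using k' by simp
    finally show ?thesis .
  qed
  have "complex_of_real (\<Sum>a<N. \<Sum>b<N. \<Prod>l\<in>u. kn n (lattice_point N z a $ l - lattice_point N z b $ l))
      = complex_of_real ((real N)\<^sup>2 * (\<Sum>k\<in>dual_box N z u n. ?w k))" for n
    by (simp only: of_real_sum of_real_prod kn double_lattice_sum[OF N] box of_real_mult of_real_power of_real_of_nat_eq cong: sum.cong)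
  then have fin: "(\<Sum>a<N. \<Sum>b<N. \<Prod>l\<in>u. kn n (lattice_point N z a $ l - lattice_point N z b $ l)) / (real N)\<^sup>2
      = (\<Sum>k\<in>dual_box N z u n. ?w k)" for n
    using N unfolding of_real_eq_iff by simp
  have "(\<lambda>n. (\<Sum>a<N. \<Sum>b<N. \<Prod>l\<in>u. kn n (lattice_point N z a $ l - lattice_point N z b $ l)) / (real N)\<^sup>2)
      \<longlonglongrightarrow> (\<Sum>a<N. \<Sum>b<N. \<Prod>l\<in>u. korobov_sum 1 (lattice_point N z a $ l - lattice_point N z b $ l)) / (real N)\<^sup>2"
    unfolding kn_def using N by (intro tendsto_intros korobov_sum_limit) auto
  then show ?thesis unfolding fin using dual_box_limit LIMSEQ_unique by blast
qed

lemma tent_in: "s \<in> {0..1} \<Longrightarrow> tent s \<in> {0..1}"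
  by (auto simp: tent_def)

lemma cos_tent: "cos (pi * real k * tent s) = cos (2 * pi * real k * s)"
proof (cases "2 * s \<le> 1")
  case False
  then have "pi * real k * tent s = 2 * real k * pi - 2 * pi * real k * s"
    by (simp add: tent_def algebra_simps)
  then show ?thesis by (simp only: cos_diff cos_2npi sin_2npi)
qed (simp add: tent_def mult_ac)

text \<open>The truncated averages are finite sums over \<open>dual_box\<close>, bounded termwise by
  products that separate in \<open>k\<close> and \<open>m\<close>; this produces the square. The
  bound is uniform in \<open>n\<close> and passes to the limit.\<close>

lemma sobolev_factor_tent_lattice_average:
  fixes z :: "nat ^ 's::finite"
  assumes N: "N > 0"
  shows "(\<Sum>a<N. \<Sum>b<N. \<Prod>l\<in>u. sobolev_factor (tent (lattice_point N z a $ l)) (tent (lattice_point N z b $ l))) / (real N)\<^sup>2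
    \<le> (29 / 6 / pi ^ 4) ^ card u * (\<Sum>\<^sub>\<infinity>k \<in> dual_lattice N z u. \<Prod>j\<in>u. 1 / (real_of_int (k j))\<^sup>2)\<^sup>2"
proof -
  let ?w = "\<lambda>k. \<Prod>j\<in>u. 1 / (real_of_int (k j))\<^sup>2"
  define W where "W = (\<Sum>\<^sub>\<infinity>k \<in> dual_lattice N z u. ?w k)"
  define C where "C = 29 / 6 / pi ^ 4"
  \<comment> \<open>The factor 4 of the cosine series is absent: it goes into the two factors
    \<open>2 * cos\<close>, each of which is a sum of two characters.\<close>
  define d where "d k l = sobolev_coeff k l / ((pi * real k)\<^sup>2 * (pi * real l)\<^sup>2)" for k l
  define sn where "sn n s t = (\<Sum>k<n. \<Sum>l<n. d (Suc k) (Suc l) *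
      (2 * cos (2 * pi * real (Suc k) * s) * (2 * cos (2 * pi * real (Suc l) * t))))" for n s t
  define c where "c k m = complex_of_real (d (nat \<bar>k\<bar>) (nat \<bar>m\<bar>))" for k m :: int
  have lim: "(\<lambda>n. sn n s t) \<longlonglongrightarrow> sobolev_factor (tent s) (tent t)" if "s \<in> {0..1}" "t \<in> {0..1}" for s t
    using sobolev_factor_cosine_series[OF tent_in[OF that(1)] tent_in[OF that(2)]]
    unfolding cos_tent sn_def d_def by (simp add: mult_ac)
  have sn: "complex_of_real (sn n s t) = (\<Sum>k\<in>nonzero_ints n. \<Sum>m\<in>nonzero_ints n. c k m
        * (cis (2 * pi * (of_int k * s)) * cis (2 * pi * (of_int m * t))))" for n s t
  proof -
    have "(\<Sum>m\<in>nonzero_ints n. c k m * (cis (2 * pi * (of_int k * s)) * cis (2 * pi * (of_int m * t))))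
       = complex_of_real (\<Sum>l<n. d (nat \<bar>k\<bar>) (Suc l) * (2 * cos (2 * pi * real (Suc l) * t)))
         * cis (2 * pi * (of_int k * s))" for k
      unfolding sum_nonzero_ints[symmetric] c_def by (simp add: sum_distrib_left mult_ac)
    then have "(\<Sum>k\<in>nonzero_ints n. \<Sum>m\<in>nonzero_ints n. c k m * (cis (2 * pi * (of_int k * s)) * cis (2 * pi * (of_int m * t))))
       = complex_of_real (\<Sum>k<n. (\<Sum>l<n. d (Suc k) (Suc l) * (2 * cos (2 * pi * real (Suc l) * t))) * (2 * cos (2 * pi * real (Suc k) * s)))"
      by (simp only: sum_nonzero_ints[where f = "\<lambda>k. \<Sum>l<n. d k (Suc l) * (2 * cos (2 * pi * real (Suc l) * t))"])
    also have "(\<Sum>k<n. (\<Sum>l<n. d (Suc k) (Suc l) * (2 * cos (2 * pi * real (Suc l) * t))) * (2 * cos (2 * pi * real (Suc k) * s))) = sn n s t"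
      unfolding sn_def sum_distrib_right by (intro sum.cong refl) (simp only: mult_ac)
    finally show ?thesis by simp
  qed
  have cb: "norm (c k m) \<le> C * (1 / (real_of_int k)\<^sup>2 * (1 / (real_of_int m)\<^sup>2))" if "k \<noteq> 0" "m \<noteq> 0" for k m
  proof -
    have "\<bar>sobolev_coeff (nat \<bar>k\<bar>) (nat \<bar>m\<bar>)\<bar> \<le> 29 / 6" using that by (intro abs_sobolev_coeff_le) auto
    then have "\<bar>sobolev_coeff (nat \<bar>k\<bar>) (nat \<bar>m\<bar>)\<bar> / (pi ^ 4 * ((real_of_int k)\<^sup>2 * (real_of_int m)\<^sup>2))
        \<le> (29 / 6) / (pi ^ 4 * ((real_of_int k)\<^sup>2 * (real_of_int m)\<^sup>2))"
      by (intro divide_right_mono) auto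
    moreover have "norm (c k m) = \<bar>sobolev_coeff (nat \<bar>k\<bar>) (nat \<bar>m\<bar>)\<bar> / (pi ^ 4 * ((real_of_int k)\<^sup>2 * (real_of_int m)\<^sup>2))"
      unfolding c_def norm_of_real d_def
      by (simp add: abs_mult power_mult_distrib power4_eq_xxxx power2_eq_square mult_ac)
    ultimately show ?thesis by (simp add: C_def)
  qed
  have w0: "0 \<le> ?w k" for k by (intro prod_nonneg) auto
  have C0: "0 \<le> C" by (simp add: C_def)
  have "(\<Sum>a<N. \<Sum>b<N. \<Prod>l\<in>u. sn n (lattice_point N z a $ l) (lattice_point N z b $ l)) / (real N)\<^sup>2 \<le> C ^ card u * W\<^sup>2" for n
  proof -
    let ?D = "dual_box N z u n"
    let ?S = "\<Sum>a<N. \<Sum>b<N. \<Prod>l\<in>u. sn n (lattice_point N z a $ l) (lattice_point N z b $ l)"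
    have "?S \<le> norm (complex_of_real ?S)" unfolding norm_of_real by (rule abs_ge_self)
    also have "complex_of_real ?S = (of_nat N)\<^sup>2 * (\<Sum>k\<in>?D. \<Sum>m\<in>?D. \<Prod>l\<in>u. c (k l) (m l))"
      by (simp only: of_real_sum of_real_prod sn double_lattice_sum[OF N])
    also have "norm \<dots> \<le> (real N)\<^sup>2 * (\<Sum>k\<in>?D. \<Sum>m\<in>?D. C ^ card u * (?w k * ?w m))"
      unfolding norm_mult norm_power norm_of_nat
    proof (intro mult_left_mono order_trans[OF norm_sum] sum_mono)
      fix k m assume "k \<in> ?D" "m \<in> ?D"
      then have nz: "k l \<noteq> 0" "m l \<noteq> 0" if "l \<in> u" for l using that by (auto simp: dual_box_def PiE_iff nonzero_ints_def)
      have "norm (\<Prod>l\<in>u. c (k l) (m l)) \<le> (\<Prod>l\<in>u. C * (1 / (real_of_int (k l))\<^sup>2 * (1 / (real_of_int (m l))\<^sup>2)))"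
        unfolding prod_norm[symmetric] by (intro prod_mono conjI norm_ge_zero cb nz)
      also have "\<dots> = C ^ card u * (?w k * ?w m)" by (simp only: prod.distrib prod_constant)
      finally show "norm (\<Prod>l\<in>u. c (k l) (m l)) \<le> C ^ card u * (?w k * ?w m)" .
    qed auto
    also have "(\<Sum>k\<in>?D. \<Sum>m\<in>?D. C ^ card u * (?w k * ?w m)) = C ^ card u * (\<Sum>k\<in>?D. ?w k)\<^sup>2"
      unfolding power2_eq_square[of "sum ?w ?D"] sum_product by (simp only: sum_distrib_left)
    \<comment> \<open>All summands are nonnegative, so a sum over a box never exceeds the full sum
      \<open>W\<close>.\<close>
    also have "\<dots> \<le> C ^ card u * W\<^sup>2"
      unfolding W_def
      by (intro mult_left_mono power_mono sum_nonneg w0 zero_le_power C0 finite_sum_le_infsum summable_on_dual_lattice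
          finite_dual_box dual_box_subset)
    finally show ?thesis using N by (simp add: field_simps mult_left_mono)
  qed
  moreover have "(\<lambda>n. (\<Sum>a<N. \<Sum>b<N. \<Prod>l\<in>u. sn n (lattice_point N z a $ l) (lattice_point N z b $ l)) / (real N)\<^sup>2)
      \<longlonglongrightarrow> (\<Sum>a<N. \<Sum>b<N. \<Prod>l\<in>u. sobolev_factor (tent (lattice_point N z a $ l)) (tent (lattice_point N z b $ l))) / (real N)\<^sup>2"
    using N by (intro tendsto_intros lim lattice_point_in) auto
  ultimately show ?thesis unfolding W_def C_def by (intro LIMSEQ_le_const2) auto
qed

section \<open>Assembly of the two inequalities\<close>

theorem theorem2:
  fixes N :: nat and z :: "nat ^ 's::finite" and \<gamma> :: "'s set \<Rightarrow> real"
    and \<gamma>' :: "'s set \<Rightarrow> real" and c' :: real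
    and Hsob Hkor :: "(real ^ 's \<Rightarrow> real) set"
    and ipsob ipkor :: "(real ^ 's \<Rightarrow> real) \<Rightarrow> (real ^ 's \<Rightarrow> real) \<Rightarrow> real"
  assumes "N \<ge> 1"
    and "\<And>j. z $ j \<in> {1..N - 1}"
    and "\<And>u. \<gamma> u \<ge> 0"
    and "c' = 58 / 3"
    and "\<And>u. \<gamma>' u = \<gamma> u * (c' / (4 * pi ^ 4)) ^ card u"
    and "rkhs (cbox 0 1) (sobolev_kernel \<gamma>) Hsob ipsob"
    and "rkhs (cbox 0 1) (korobov_kernel 1 (\<lambda>u. sqrt (\<gamma>' u))) Hkor ipkor"
  shows "(worst_case_error (tent_lattice_points N z) Hsob (rkhs_norm ipsob)) ^ 2
           \<le> ennreal (\<Sum>u \<in> UNIV - {{}}. \<gamma>' u *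
               (\<Sum>\<^sub>\<infinity>k \<in> dual_lattice N z u. \<Prod>j\<in>u. 1 / (real_of_int (k j)) ^ 2) ^ 2)
       \<and> ennreal (\<Sum>u \<in> UNIV - {{}}. \<gamma>' u *
               (\<Sum>\<^sub>\<infinity>k \<in> dual_lattice N z u. \<Prod>j\<in>u. 1 / (real_of_int (k j)) ^ 2) ^ 2)
           \<le> (worst_case_error (lattice_points N z) Hkor (rkhs_norm ipkor)) ^ 4"
proof
  define W where "W u = (\<Sum>\<^sub>\<infinity>k \<in> dual_lattice N z u. \<Prod>j\<in>u. 1 / (real_of_int (k j)) ^ 2)" for u
  define p where "p = lattice_point N z"
  define q where "q n = (\<chi> j. tent (p n $ j))" for n
  have N: "N > 0" using assms(1) by simp
  have p01: "p n \<in> cbox 0 1" for n using lattice_point_in[of N z n] by (auto simp: p_def mem_box_cart)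
  have q01: "q n \<in> cbox 0 1" for n using tent_in[OF lattice_point_in[of N z n]] by (auto simp: q_def p_def mem_box_cart)
  have P: "lattice_points N z = image_mset p (mset_set {0..<N})"
    by (simp add: lattice_points_def p_def lattice_point_def[abs_def])
  have Q: "tent_lattice_points N z = image_mset q (mset_set {0..<N})"
    by (simp add: tent_lattice_points_def P q_def[abs_def] image_mset.compositionality o_def)
  have \<gamma>': "\<gamma>' u = \<gamma> u * (29 / 6 / pi ^ 4) ^ card u" for u
    by (simp add: assms(4,5))
  have \<gamma>'0: "0 \<le> \<gamma>' u" for u unfolding \<gamma>' using assms(3)[of u] by simp
  have W0: "0 \<le> W u" for u unfolding W_def by (intro infsum_nonneg prod_nonneg) auto
  have "(worst_case_error (tent_lattice_points N z) Hsob (rkhs_norm ipsob))\<^sup>2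
      = ennreal (\<Sum>u \<in> UNIV - {{}}. \<gamma> u * ((\<Sum>i<N. \<Sum>j<N. \<Prod>l\<in>u. sobolev_factor (q i $ l) (q j $ l)) / (real N)\<^sup>2))"
    unfolding Q
    by (rule worst_case_error_tensor_kernel[OF assms(6) _ continuous_on_sobolev_factor integral_sobolev_factor N q01])
       (simp_all add: sobolev_kernel_def sobolev_factor_def)
  also have "\<dots> \<le> ennreal (\<Sum>u \<in> UNIV - {{}}. \<gamma>' u * (W u)\<^sup>2)"
  proof (intro ennreal_leI sum_mono)
    fix u
    have "(\<Sum>i<N. \<Sum>j<N. \<Prod>l\<in>u. sobolev_factor (q i $ l) (q j $ l)) / (real N)\<^sup>2 \<le> (29 / 6 / pi ^ 4) ^ card u * (W u)\<^sup>2"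
      using sobolev_factor_tent_lattice_average[OF N, where u = u and z = z] by (simp add: q_def p_def W_def)
    from mult_left_mono[OF this assms(3)[of u]]
    show "\<gamma> u * ((\<Sum>i<N. \<Sum>j<N. \<Prod>l\<in>u. sobolev_factor (q i $ l) (q j $ l)) / (real N)\<^sup>2) \<le> \<gamma>' u * (W u)\<^sup>2"
      by (simp only: \<gamma>' mult.assoc)
  qed
  finally show "(worst_case_error (tent_lattice_points N z) Hsob (rkhs_norm ipsob)) ^ 2
           \<le> ennreal (\<Sum>u \<in> UNIV - {{}}. \<gamma>' u *
               (\<Sum>\<^sub>\<infinity>k \<in> dual_lattice N z u. \<Prod>j\<in>u. 1 / (real_of_int (k j)) ^ 2) ^ 2)"
    by (simp only: W_def)
  have kor: "(worst_case_error (lattice_points N z) Hkor (rkhs_norm ipkor))\<^sup>2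
      = ennreal (\<Sum>u \<in> UNIV - {{}}. sqrt (\<gamma>' u) * ((\<Sum>i<N. \<Sum>j<N. \<Prod>l\<in>u. korobov_sum 1 (p i $ l - p j $ l)) / (real N)\<^sup>2))"
    unfolding P
    by (rule worst_case_error_tensor_kernel[OF assms(7) _ continuous_on_korobov_sum integral_korobov_sum N p01])
       (simp_all add: korobov_kernel_def)
  \<comment> \<open>With weights \<open>sqrt (\<gamma>' u)\<close> the squared Korobov error is the
    sum of \<open>sqrt (\<gamma>' u) * W u\<close>. The middle expression is the sum of the squares
    of the same terms, which explains both the root of the weights and the fourth power.\<close>
  have "(\<Sum>u \<in> UNIV - {{}}. \<gamma>' u * (W u)\<^sup>2) = (\<Sum>u \<in> UNIV - {{}}. (sqrt (\<gamma>' u) * W u)\<^sup>2)"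
    using \<gamma>'0 by (simp add: power_mult_distrib)
  also have "\<dots> \<le> (\<Sum>u \<in> UNIV - {{}}. sqrt (\<gamma>' u) * W u)\<^sup>2"
    unfolding power2_eq_square sum_product
    by (intro sum_mono member_le_sum mult_nonneg_nonneg W0) (auto simp: \<gamma>'0)
  finally have "ennreal (\<Sum>u \<in> UNIV - {{}}. \<gamma>' u * (W u)\<^sup>2)
      \<le> ennreal ((\<Sum>u \<in> UNIV - {{}}. sqrt (\<gamma>' u) * W u)\<^sup>2)"
    by (rule ennreal_leI)
  also have "\<dots> = ((worst_case_error (lattice_points N z) Hkor (rkhs_norm ipkor))\<^sup>2)\<^sup>2"
    unfolding kor p_def korobov_lattice_average[OF N] W_def[symmetric]
    by (rule ennreal_power[symmetric]) (intro sum_nonneg mult_nonneg_nonneg W0, auto simp: \<gamma>'0)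
  also have "\<dots> = (worst_case_error (lattice_points N z) Hkor (rkhs_norm ipkor)) ^ 4"
    by (simp flip: power_mult)
  finally show "ennreal (\<Sum>u \<in> UNIV - {{}}. \<gamma>' u *
               (\<Sum>\<^sub>\<infinity>k \<in> dual_lattice N z u. \<Prod>j\<in>u. 1 / (real_of_int (k j)) ^ 2) ^ 2)
           \<le> (worst_case_error (lattice_points N z) Hkor (rkhs_norm ipkor)) ^ 4"
    by (simp only: W_def)
qed

end
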